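(* Let $s\in(0,\infty)$, let $b=(b_+,b_-)$ be a pair of real numbers, $p\in(D/[D+s],\infty)$, $q\in(0,\infty]$, and $W\in A_p(\mathcal X,\mathbb C^m)$. Then every $\vec f\in\dot N^{s,b}_{p,q}(\mathcal X,W)$ belongs to $[L^1_{\mathrm{loc}}(\mathcal X)]^m$.
   Context: Space. $(\mathcal X,d,\mu)$ is a space of homogeneous type: $d:\mathcal X\times\mathcal X\to[0,\infty)$ is a quasi-metric ($d(x,y)=0$ iff $x=y$; $d(x,y)=d(y,x)$; $d(x,y)\le A_0[d(x,z)+d(z,y)]$ with a constant $A_0\in[1,\infty)$), and $\mu$ is a regular Borel measure such that all balls $B(x,r)=\{y:d(x,y)<r\}$ have finite positive measure and $\mu(2B)\le C_\mu\,\mu(B)$ for all balls $B$, where $\lambda B$ is the ball with the same center and $\lambda$ times the radius. $C_\mu\ge1$ is the smallest such constant and $D:=\log_2C_\mu$, so $\mu(\lambda B)\le C_\mu\lambda^D\mu(B)$ for $\lambda\ge1$. It is assumed that $\mu(\{x\})=0$ for all $x$. $m\in\mathbb N$; $\|\cdot\|$ is the Euclidean norm on $\mathbb C^m$ and the operator norm on $m\times m$ matrices. $[L^0(\mathcal X)]^m$ is the set of $\mathbb C^m$-valued measurable, a.e. finite functions. A measurable function $f$ is in $L^1_{\mathrm{loc}}(\mathcal X)$ if for every $x_0\in\mathcal X$ there is $r_0>0$ with $f\mathbf 1_{B(x_0,r_0)}\in L^1(\mathcal X)$. Dyadic cubes. Fixed constants $0<\delta<\min\{A_0^{-D},(2A_0)^{-1},(12A_0^3)^{-1}\}$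 and $0<c_0\le C_0<\infty$ with $12A_0^3C_0\delta\le c_0$. For each $k\in\mathbb Z$, $\{z^k_\alpha\}_{\alpha\in\mathcal I_k}\subset\mathcal X$ satisfies $d(z^k_\alpha,z^k_\beta)\ge c_0\delta^k$ for $\alpha\ne\beta$ and $\min_\alpha d(x,z^k_\alpha)<C_0\delta^k$ for all $x$. $\mathcal Q=\bigcup_{k}\mathcal Q_k$, $\mathcal Q_k=\{Q^k_\alpha\}_{\alpha\in\mathcal I_k}$, is a fixed system of dyadic cubes: for each $k$, $\mathcal X$ is the disjoint union of the $Q^k_\alpha$; for $j\ge k$ either $Q^j_\beta\subset Q^k_\alpha$ or $Q^j_\beta\cap Q^k_\alpha=\emptyset$; and $B(z^k_\alpha,(3A_0^2)^{-1}c_0\delta^k)\subset Q^k_\alpha\subset B(z^k_\alpha,2A_0C_0\delta^k)$. Weights. A matrix weight is a map $W$ from $\mathcal X$ to the nonnegative definite complex $m\times m$ matrices, invertible a.e., with locally integrable entries. Powers $W^r(x)$ are defined spectrally. $W\in A_p(\mathcal X,\mathbb C^m)$ means: for $p\in(0,1]$, $\sup_B\operatorname{ess\,sup}_{y\in B}\frac1{\mu(B)}\int_B\|W^{1/p}(x)W^{-1/p}(y)\|^p\,d\mu(x)<\infty$; for $p\in(1,\infty)$ and $1/p+1/p'=1$, $\sup_B\frac1{\mu(B)}\int_B\big[\frac1{\mu(B)}\int_B\|W^{1/p}(x)W^{-1/p}(y)\|^{p'}d\mu(y)\big]^{p/p'}d\mu(x)<\infty$ (suprema over all balls). A family $\{A_Q\}_{Q\in\mathcal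 Q}$ of positive definite $m\times m$ matrices is a family of reducing operators of order $p$ for $W$ if $\|A_Q\vec\eta\|\sim\big\{\frac1{\mu(Q)}\int_Q\|W^{1/p}(x)\vec\eta\|^pd\mu(x)\big\}^{1/p}$ for all $\vec\eta\in\mathbb C^m$, $Q\in\mathcal Q$, with equivalence constants independent of $\vec\eta$ and $Q$. Logarithmic weight. $L_{s,b}(t):=t^s[1+\log_\delta(1\wedge t)]^{-b_+}[1+|\log_\delta(1\vee t)|]^{-b_-}$, $t\in(0,\infty)$, where $\wedge,\vee$ denote min, max. Hajłasz–Besov space. For $\vec f\in[L^0(\mathcal X)]^m$, $\mathbb D^{s,b}_{\{A_Q\}}(\vec f)$ is the set of sequences $\{\vec g_k\}_{k\in\mathbb Z}$ of $\mathbb C^m$-valued measurable functions such that for each $k$ there is a $\mu$-null set $N_k$ such that, for all $x,y\in\mathcal X\setminus N_k$ with $d(x,y)\in[\delta^{k+1},\delta^k)$, $$\sum_{Q\in\mathcal Q_k}\|A_Q\vec f(x)-A_Q\vec f(y)\|\mathbf 1_Q(x)\le L_{s,b}(d(x,y))\sum_{Q\in\mathcal Q_k}[\|A_Q\vec g_k(x)\|+\|A_Q\vec g_k(y)\|]\mathbf 1_Q(x).$$ With a family $\{A_Q\}_{Q\in\mathcal Q}$ of reducing operators of order $p$ for $W$ fixed, $\dot N^{s,b}_{p,q}(\mathcal X,W)$ is the set of $\vec f\in[L^0(\mathcal X)]^m$ with $$\|\vec f\|_{\dot N^{s,b}_{p,q}(\mathcal X,W)}:=\inf_{\{\vec g_k\}\in\mathbb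 D^{s,b}_{\{A_Q\}}(\vec f)}\Big[\sum_{k\in\mathbb Z}\Big(\int_{\mathcal X}\|W^{1/p}(x)\vec g_k(x)\|^pd\mu(x)\Big)^{q/p}\Big]^{1/q}<\infty$$ (usual modification for $q=\infty$). *)

theory Defs
  imports "HOL-Probability.Essential_Supremum"
begin

section \<open>Spaces of homogeneous type\<close>

definition qball :: "('a \<Rightarrow> 'a \<Rightarrow> real) \<Rightarrow> 'a \<Rightarrow> real \<Rightarrow> 'a set" where
  "qball d x r = {y. d x y < r}"

text \<open>The topology induced by a quasi-metric. Quasi-metric balls need not be open, nor even Borel.\<close>

definition qopen :: "('a \<Rightarrow> 'a \<Rightarrow> real) \<Rightarrow> 'a set \<Rightarrow> bool" where
  "qopen d U \<longleftrightarrow> (\<forall>x\<in>U. \<exists>r>0. qball d x r \<subseteq> U)"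

definition qborel :: "('a \<Rightarrow> 'a \<Rightarrow> real) \<Rightarrow> 'a set set" where
  "qborel d = sigma_sets UNIV {U. qopen d U}"

text \<open>The whole type \<open>'a\<close> is the underlying set. The measure lives on some \<open>\<sigma>\<close>-algebra containing
  the Borel sets and the balls (for instance the Borel \<open>\<sigma>\<close>-algebra, if balls are Borel, or its
  completion). Regularity is Borel regularity: measurable sets have Borel envelopes of the same
  measure.\<close>

locale homogeneous_space =
  fixes d :: "'a \<Rightarrow> 'a \<Rightarrow> real" and A0 :: real and M :: "'a measure"
  assumes d_nonneg: "0 \<le> d x y"
    and d_eq_0_iff: "d x y = 0 \<longleftrightarrow> x = y"
    and d_commute: "d x y = d y x"
    and A0_ge_1: "1 \<le> A0"
    and d_quasi_triangle: "d x y \<le> A0 * (d x z + d z y)"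
    and space_M: "space M = UNIV"
    and qborel_sets: "qborel d \<subseteq> sets M"
    and qball_sets: "qball d x r \<in> sets M"
    and borel_regular: "E \<in> sets M \<Longrightarrow> \<exists>F\<in>qborel d. E \<subseteq> F \<and> emeasure M F = emeasure M E"
    and qball_pos: "0 < r \<Longrightarrow> 0 < emeasure M (qball d x r)"
    and qball_finite: "0 < r \<Longrightarrow> emeasure M (qball d x r) < \<infinity>"
    and doubling: "\<exists>C. \<forall>x r. 0 < r \<longrightarrow> measure M (qball d x (2 * r)) \<le> C * measure M (qball d x r)"

definition doubling_const :: "('a \<Rightarrow> 'a \<Rightarrow> real) \<Rightarrow> 'a measure \<Rightarrow> real" where
  "doubling_const d M = Inf {C. 1 \<le> C \<and>
     (\<forall>x r. 0 < r \<longrightarrow> measure M (qball d x (2 * r)) \<le> C * measure M (qball d x r))}"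

definition upper_dim :: "('a \<Rightarrow> 'a \<Rightarrow> real) \<Rightarrow> 'a measure \<Rightarrow> real" where
  "upper_dim d M = log 2 (doubling_const d M)"

definition L1_loc :: "('a \<Rightarrow> 'a \<Rightarrow> real) \<Rightarrow> 'a measure \<Rightarrow> ('a \<Rightarrow> complex) set" where
  "L1_loc d M = {f \<in> borel_measurable M. \<forall>x0. \<exists>r>0. set_integrable M (qball d x0 r) f}"

definition L1_loc_vec :: "('a \<Rightarrow> 'a \<Rightarrow> real) \<Rightarrow> 'a measure \<Rightarrow> ('a \<Rightarrow> complex^'m) set" where
  "L1_loc_vec d M = {f. \<forall>i. (\<lambda>x. f x $ i) \<in> L1_loc d M}"


section \<open>Dyadic cubes\<close>

text \<open>Cubes are labelled by their level \<open>k\<close> and an index \<open>\<alpha> \<in> I k\<close>, since one and the same set may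
  occur as a cube of several levels. Measurability of the cubes is implicit in speaking of averages
  over them.\<close>

locale dyadic_system = homogeneous_space d A0 M
  for d :: "'a \<Rightarrow> 'a \<Rightarrow> real" and A0 :: real and M :: "'a measure" +
  fixes \<delta> c0 C0 :: real and I :: "int \<Rightarrow> 'i set" and z :: "int \<Rightarrow> 'i \<Rightarrow> 'a"
    and Q :: "int \<Rightarrow> 'i \<Rightarrow> 'a set"
  assumes delta_pos: "0 < \<delta>"
    and delta_less: "\<delta> < Min {A0 powr (- upper_dim d M), inverse (2 * A0), inverse (12 * A0 ^ 3)}"
    and c0_pos: "0 < c0" and c0_le_C0: "c0 \<le> C0"
    and C0_delta_le: "12 * A0 ^ 3 * C0 * \<delta> \<le> c0"
    and centers_separated:
      "\<lbrakk>\<alpha> \<in> I k; \<beta> \<in> I k; \<alpha> \<noteq> \<beta>\<rbrakk> \<Longrightarrow> c0 * \<delta> powi k \<le> d (z k \<alpha>) (z k \<beta>)"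
    and centers_dense: "\<exists>\<alpha>\<in>I k. d x (z k \<alpha>) < C0 * \<delta> powi k"
    and cubes_sets: "\<alpha> \<in> I k \<Longrightarrow> Q k \<alpha> \<in> sets M"
    and cubes_cover: "(\<Union>\<alpha>\<in>I k. Q k \<alpha>) = UNIV"
    and cubes_disjoint: "disjoint_family_on (Q k) (I k)"
    and cubes_nested:
      "\<lbrakk>k \<le> j; \<alpha> \<in> I k; \<beta> \<in> I j\<rbrakk> \<Longrightarrow> Q j \<beta> \<subseteq> Q k \<alpha> \<or> Q j \<beta> \<inter> Q k \<alpha> = {}"
    and cube_inner: "\<alpha> \<in> I k \<Longrightarrow> qball d (z k \<alpha>) (inverse (3 * A0\<^sup>2) * c0 * \<delta> powi k) \<subseteq> Q k \<alpha>"
    and cube_outer: "\<alpha> \<in> I k \<Longrightarrow> Q k \<alpha> \<subseteq> qball d (z k \<alpha>) (2 * A0 * C0 * \<delta> powi k)"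


section \<open>Matrices\<close>

text \<open>The type-class norm on \<open>complex^'m^'m\<close> is the Frobenius norm, hence a separate operator norm.
  The type-class norm on \<open>complex^'m\<close> is the Euclidean one.\<close>

definition op_norm :: "complex^'m^'m \<Rightarrow> real" where
  "op_norm A = onorm (\<lambda>v. A *v v)"

definition conj_transpose :: "complex^'m^'m \<Rightarrow> complex^'m^'m" where
  "conj_transpose A = (\<chi> i j. cnj (A $ j $ i))"

definition quad_form :: "complex^'m^'m \<Rightarrow> complex^'m \<Rightarrow> complex" where
  "quad_form A v = (\<Sum>i\<in>UNIV. cnj (v $ i) * (A *v v) $ i)"

definition nonneg_definite :: "complex^'m^'m \<Rightarrow> bool" where
  "nonneg_definite A \<longleftrightarrow> conj_transpose A = A \<and> (\<forall>v. 0 \<le> Re (quad_form A v))"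

definition pos_definite :: "complex^'m^'m \<Rightarrow> bool" where
  "pos_definite A \<longleftrightarrow> conj_transpose A = A \<and> (\<forall>v. v \<noteq> 0 \<longrightarrow> 0 < Re (quad_form A v))"

definition unitary_mat :: "complex^'m^'m \<Rightarrow> bool" where
  "unitary_mat U \<longleftrightarrow> conj_transpose U ** U = mat 1 \<and> U ** conj_transpose U = mat 1"

definition diag_mat :: "('m \<Rightarrow> real) \<Rightarrow> complex^'m^'m" where
  "diag_mat l = (\<chi> i j. if i = j then complex_of_real (l i) else 0)"

text \<open>Spectral powers; the value does not depend on the diagonalization. It is meant for nonnegative
  definite matrices, and for negative exponents only for invertible ones.\<close>

definition mat_powr :: "complex^'m^'m \<Rightarrow> real \<Rightarrow> complex^'m^'m" where
  "mat_powr A r = (THE B. \<exists>U l. unitary_mat U \<and> A = U ** diag_mat l ** conj_transpose U \<and>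
     B = U ** diag_mat (\<lambda>i. l i powr r) ** conj_transpose U)"


section \<open>Matrix weights\<close>

text \<open>Real powers of extended nonnegative numbers, for positive exponents.\<close>

definition ennpowr :: "ennreal \<Rightarrow> real \<Rightarrow> ennreal" where
  "ennpowr x r = (if x = \<infinity> then \<infinity> else ennreal (enn2real x powr r))"

definition avg :: "'a measure \<Rightarrow> 'a set \<Rightarrow> ('a \<Rightarrow> ennreal) \<Rightarrow> ennreal" where
  "avg M B h = (\<integral>\<^sup>+x\<in>B. h x \<partial>M) / emeasure M B"

definition matrix_weight :: "('a \<Rightarrow> 'a \<Rightarrow> real) \<Rightarrow> 'a measure \<Rightarrow> ('a \<Rightarrow> complex^'m^'m) \<Rightarrow> bool" where
  "matrix_weight d M W \<longleftrightarrow> (\<forall>x. nonneg_definite (W x)) \<and> (AE x in M. invertible (W x)) \<and>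
     (\<forall>i j. (\<lambda>x. W x $ i $ j) \<in> L1_loc d M)"

definition Ap_char :: "('a \<Rightarrow> 'a \<Rightarrow> real) \<Rightarrow> 'a measure \<Rightarrow> real \<Rightarrow> ('a \<Rightarrow> complex^'m^'m) \<Rightarrow> ennreal" where
  "Ap_char d M p W =
    (let K = (\<lambda>x y. op_norm (mat_powr (W x) (1 / p) ** mat_powr (W y) (- 1 / p))) in
     if p \<le> 1 then
       (SUP (x0, r) \<in> UNIV \<times> {0<..}. let B = qball d x0 r in
          esssup (restrict_space M B) (\<lambda>y. avg M B (\<lambda>x. ennreal (K x y powr p))))
     else
       (let p' = p / (p - 1) in
        SUP (x0, r) \<in> UNIV \<times> {0<..}. let B = qball d x0 r in
          avg M B (\<lambda>x. ennpowr (avg M B (\<lambda>y. ennreal (K x y powr p'))) (p / p'))))"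

definition Ap_weights :: "('a \<Rightarrow> 'a \<Rightarrow> real) \<Rightarrow> 'a measure \<Rightarrow> real \<Rightarrow> ('a \<Rightarrow> complex^'m^'m) set" where
  "Ap_weights d M p = {W. matrix_weight d M W \<and> Ap_char d M p W < \<infinity>}"

definition reducing_operators ::
  "'a measure \<Rightarrow> (int \<Rightarrow> 'i set) \<Rightarrow> (int \<Rightarrow> 'i \<Rightarrow> 'a set) \<Rightarrow> real \<Rightarrow> ('a \<Rightarrow> complex^'m^'m) \<Rightarrow>
     (int \<Rightarrow> 'i \<Rightarrow> complex^'m^'m) \<Rightarrow> bool" where
  "reducing_operators M I Q p W A \<longleftrightarrow>
     (\<forall>k. \<forall>\<alpha>\<in>I k. pos_definite (A k \<alpha>)) \<and>
     (\<exists>c C :: real. 0 < c \<and> 0 < C \<and> (\<forall>k. \<forall>\<alpha>\<in>I k. \<forall>\<eta>.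
        (let w = ennpowr (avg M (Q k \<alpha>) (\<lambda>x. ennreal (norm (mat_powr (W x) (1 / p) *v \<eta>) powr p))) (1 / p)
         in ennreal c * w \<le> ennreal (norm (A k \<alpha> *v \<eta>)) \<and>
            ennreal (norm (A k \<alpha> *v \<eta>)) \<le> ennreal C * w)))"


section \<open>Matrix-weighted Hajlasz--Besov spaces with logarithmic smoothness\<close>

text \<open>\<open>b = (b\<^sub>+, b\<^sub>-)\<close>\<close>

definition log_weight :: "real \<Rightarrow> real \<Rightarrow> real \<times> real \<Rightarrow> real \<Rightarrow> real" where
  "log_weight \<delta> s b t = t powr s * (1 + log \<delta> (min 1 t)) powr (- fst b) *
     (1 + \<bar>log \<delta> (max 1 t)\<bar>) powr (- snd b)"

text \<open>The sums over the cubes of one level are possibly infinite, but with at most one nonzero term.\<close>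

definition hajlasz_gradients ::
  "'a measure \<Rightarrow> ('a \<Rightarrow> 'a \<Rightarrow> real) \<Rightarrow> real \<Rightarrow> (int \<Rightarrow> 'i set) \<Rightarrow> (int \<Rightarrow> 'i \<Rightarrow> 'a set) \<Rightarrow>
     (int \<Rightarrow> 'i \<Rightarrow> complex^'m^'m) \<Rightarrow> real \<Rightarrow> real \<times> real \<Rightarrow> ('a \<Rightarrow> complex^'m) \<Rightarrow>
     (int \<Rightarrow> 'a \<Rightarrow> complex^'m) set" where
  "hajlasz_gradients M d \<delta> I Q A s b f = {g. \<forall>k. g k \<in> borel_measurable M \<and>
     (\<exists>N\<in>null_sets M. \<forall>x y. x \<notin> N \<longrightarrow> y \<notin> N \<longrightarrow> d x y \<in> {\<delta> powi (k + 1)..<\<delta> powi k} \<longrightarrow>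
        (\<Sum>\<^sub>\<infinity>\<alpha>\<in>I k. norm (A k \<alpha> *v f x - A k \<alpha> *v f y) * indicator (Q k \<alpha>) x)
        \<le> log_weight \<delta> s b (d x y) *
          (\<Sum>\<^sub>\<infinity>\<alpha>\<in>I k. (norm (A k \<alpha> *v g k x) + norm (A k \<alpha> *v g k y)) * indicator (Q k \<alpha>) x))}"

definition weighted_lq_Lp_norm ::
  "'a measure \<Rightarrow> real \<Rightarrow> ennreal \<Rightarrow> ('a \<Rightarrow> complex^'m^'m) \<Rightarrow> (int \<Rightarrow> 'a \<Rightarrow> complex^'m) \<Rightarrow> ennreal" where
  "weighted_lq_Lp_norm M p q W g =
    (let n = (\<lambda>k. \<integral>\<^sup>+x. ennreal (norm (mat_powr (W x) (1 / p) *v g k x) powr p) \<partial>M) in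
     if q = \<infinity> then (SUP k. ennpowr (n k) (1 / p))
     else ennpowr (\<Sum>\<^sub>\<infinity>k. ennpowr (n k) (enn2real q / p)) (1 / enn2real q))"

definition hajlasz_besov_norm ::
  "'a measure \<Rightarrow> ('a \<Rightarrow> 'a \<Rightarrow> real) \<Rightarrow> real \<Rightarrow> (int \<Rightarrow> 'i set) \<Rightarrow> (int \<Rightarrow> 'i \<Rightarrow> 'a set) \<Rightarrow>
     (int \<Rightarrow> 'i \<Rightarrow> complex^'m^'m) \<Rightarrow> real \<Rightarrow> real \<times> real \<Rightarrow> real \<Rightarrow> ennreal \<Rightarrow>
     ('a \<Rightarrow> complex^'m^'m) \<Rightarrow> ('a \<Rightarrow> complex^'m) \<Rightarrow> ennreal" where
  "hajlasz_besov_norm M d \<delta> I Q A s b p q W f =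
     (INF g \<in> hajlasz_gradients M d \<delta> I Q A s b f. weighted_lq_Lp_norm M p q W g)"

definition hajlasz_besov_space ::
  "'a measure \<Rightarrow> ('a \<Rightarrow> 'a \<Rightarrow> real) \<Rightarrow> real \<Rightarrow> (int \<Rightarrow> 'i set) \<Rightarrow> (int \<Rightarrow> 'i \<Rightarrow> 'a set) \<Rightarrow>
     (int \<Rightarrow> 'i \<Rightarrow> complex^'m^'m) \<Rightarrow> real \<Rightarrow> real \<times> real \<Rightarrow> real \<Rightarrow> ennreal \<Rightarrow>
     ('a \<Rightarrow> complex^'m^'m) \<Rightarrow> ('a \<Rightarrow> complex^'m) set" where
  "hajlasz_besov_space M d \<delta> I Q A s b p q W =
     {f \<in> borel_measurable M. hajlasz_besov_norm M d \<delta> I Q A s b p q W f < \<infinity>}"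

end

theory Submission
  imports Defs
begin

text \<open>
  The level \<open>k\<close> of the Hajlasz inequality controls \<open>f\<close> at distance about \<open>\<delta> ^ k\<close> by
  \<open>h\<^sub>k = \<parallel>W\<^bsup>1/p\<^esup> g\<^sub>k\<parallel>\<close>, whose \<open>L\<^sup>p\<close> norms are bounded uniformly in \<open>k\<close>.

  For \<open>p > 1\<close> the \<open>A\<^sub>p\<close> condition gives \<open>\<parallel>g\<^sub>k\<parallel> \<le> \<kappa> h\<^sub>k\<close> with \<open>\<kappa>\<close> locally in \<open>L\<^bsup>p'\<^esup>\<close>, so \<open>g\<^sub>k\<close> is
  locally integrable. As \<open>\<mu>\<close> has no atoms, near \<open>x\<^sub>0\<close> there is a good point \<open>y\<^sub>0 \<noteq> x\<^sub>0\<close>, and a small ball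
  around \<open>x\<^sub>0\<close> is covered by finitely many annuli around \<open>y\<^sub>0\<close>, on which \<open>f\<close> is dominated by \<open>g\<^sub>k\<close>.

  For \<open>p \<le> 1\<close> the \<open>A\<^sub>p\<close> condition bounds the reducing operators, locally and uniformly in the level, by
  \<open>W\<^bsup>1/p\<^esup>\<close> from above and by a constant from below, so that \<open>\<parallel>f x - f y\<parallel> \<le> C d(x, y)\<^bsup>s'\<^esup> (h\<^sub>k x + h\<^sub>k y)\<close>
  for some \<open>s' < s\<close>. Put \<open>F\<^sub>n = (\<Sum>k\<ge>n. (\<delta> ^ (k s') h\<^sub>k)\<^sup>p)\<close>, up to a constant, and let \<open>D\<close> be slightly larger than the upper
  dimension. In the ball of radius about \<open>\<delta> ^ n\<close> around \<open>x\<close>, of measure at least about \<open>\<delta> ^ (n D)\<close>,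
  there is a point at which \<open>F\<^sub>n\<close> is at most about \<open>\<delta> ^ (- n p \<gamma>)\<close>, where \<open>p \<gamma> = D - s' p\<close>. Chaining these points
  gives \<open>\<parallel>f x\<parallel>\<^sup>p \<le> C \<delta> ^ (- n p \<gamma>) + F\<^sub>n x\<close> for every \<open>n\<close>. The set where the second term dominates has measure
  \<open>O(\<delta> ^ (n D))\<close>, and \<open>\<gamma> < D\<close> can be achieved exactly because \<open>p > D / (D + s)\<close>; hence \<open>f\<close> is locally integrable.
\<close>

section \<open>Spectral powers of nonnegative definite matrices\<close>

definition hermitian_prod :: "complex^'m \<Rightarrow> complex^'m \<Rightarrow> complex" where
  "hermitian_prod u v = (\<Sum>i\<in>UNIV. cnj (u $ i) * v $ i)"

lemma hermitian_prod_simps: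
  "hermitian_prod u (v + w) = hermitian_prod u v + hermitian_prod u w"
  "hermitian_prod u (v - w) = hermitian_prod u v - hermitian_prod u w"
  "hermitian_prod u (c *s v) = c * hermitian_prod u v"
  "hermitian_prod u (r *\<^sub>R v) = of_real r * hermitian_prod u v"
  "hermitian_prod u 0 = 0"
  by (simp_all add: hermitian_prod_def algebra_simps sum.distrib sum_subtractf sum_distrib_left
      scaleR_conv_of_real[where 'a=complex] mult_ac)

lemma hermitian_prod_sum: "hermitian_prod u (\<Sum>x\<in>S. g x) = (\<Sum>x\<in>S. hermitian_prod u (g x))"
  by (induction S rule: infinite_finite_induct) (auto simp: hermitian_prod_simps)

lemma cnj_hermitian_prod: "cnj (hermitian_prod u v) = hermitian_prod v u"
  by (simp add: hermitian_prod_def mult.commute)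

text \<open>The real inner product of the type class serves the variational argument for
  eigenvectors, while orthogonality over the complex numbers needs the full product. This identity
  links the two.\<close>

lemma Re_hermitian_prod: "Re (hermitian_prod u v) = u \<bullet> v"
  by (simp add: hermitian_prod_def inner_vec_def inner_complex_def)

lemma hermitian_prod_self: "hermitian_prod u u = complex_of_real ((norm u)\<^sup>2)"
proof (rule complex_eqI)
  show "Re (hermitian_prod u u) = Re (complex_of_real ((norm u)\<^sup>2))"
    by (simp add: Re_hermitian_prod power2_norm_eq_inner)
  have "cnj (hermitian_prod u u) = hermitian_prod u u" by (rule cnj_hermitian_prod)
  then show "Im (hermitian_prod u u) = Im (complex_of_real ((norm u)\<^sup>2))"
    by (metis Im_complex_of_real Reals_cnj_iff complex_is_Real_iff)
qed

lemma hermitian_prod_conj_transpose: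
  "hermitian_prod (conj_transpose A *v u) v = hermitian_prod u (A *v v)"
proof -
  have "hermitian_prod (conj_transpose A *v u) v = (\<Sum>i\<in>UNIV. \<Sum>j\<in>UNIV. cnj (u $ j) * A $ j $ i * v $ i)"
    by (simp add: hermitian_prod_def conj_transpose_def matrix_vector_mult_def sum_distrib_left sum_distrib_right mult_ac)
  also have "\<dots> = (\<Sum>j\<in>UNIV. \<Sum>i\<in>UNIV. cnj (u $ j) * A $ j $ i * v $ i)"
    by (rule sum.swap)
  also have "\<dots> = hermitian_prod u (A *v v)"
    by (simp add: hermitian_prod_def matrix_vector_mult_def sum_distrib_left mult_ac)
  finally show ?thesis .
qed

lemma quad_form_hermitian_prod: "quad_form A v = hermitian_prod v (A *v v)"
  by (simp add: quad_form_def hermitian_prod_def)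

lemma matrix_vector_mult_scaleR: "(A :: complex^'n^'m) *v (r *\<^sub>R v) = r *\<^sub>R (A *v v)"
  by (simp add: vec_eq_iff matrix_vector_mult_def scaleR_sum_right)

lemma bounded_linear_matrix_vector_mult_complex: "bounded_linear (\<lambda>v. (A :: complex^'n^'m) *v v)"
  by (intro linear_conv_bounded_linear[THEN iffD1] linearI matrix_vector_mult_scaleR
      matrix_vector_right_distrib)

section \<open>Eigenvectors and unitary diagonalization\<close>

text \<open>A maximizer of the quadratic form on the unit sphere of an invariant subspace is an
  eigenvector.\<close>

lemma self_adjoint_eigenvector_in_invariant_subspace:
  fixes A :: "complex^'m^'m"
  assumes A: "conj_transpose A = A"
    and V: "subspace V" "\<And>v. v \<in> V \<Longrightarrow> A *v v \<in> V" "\<exists>v\<in>V. v \<noteq> 0"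
  obtains v l where "v \<in> V" "norm v = 1" "A *v v = l *\<^sub>R v"
proof -
  have sym: "(A *v u) \<bullet> v = u \<bullet> (A *v v)" for u v
    using hermitian_prod_conj_transpose[of A u v] by (metis A Re_hermitian_prod)
  define S where "S = V \<inter> sphere 0 1"
  have "compact S"
    unfolding S_def by (intro closed_Int_compact closed_subspace V compact_sphere)
  moreover have "S \<noteq> {}"
  proof -
    obtain v where v: "v \<in> V" "v \<noteq> 0" using V by blast
    then have "(1 / norm v) *\<^sub>R v \<in> S" unfolding S_def
      using V(1) by (auto simp: subspace_scale)
    then show ?thesis by blast
  qed
  moreover have "continuous_on S (\<lambda>v. v \<bullet> (A *v v))"
    by (intro continuous_intros linear_continuous_on_compose bounded_linear.linear
        bounded_linear_matrix_vector_mult_complex)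
  ultimately obtain v where v: "v \<in> S" "\<And>u. u \<in> S \<Longrightarrow> u \<bullet> (A *v u) \<le> v \<bullet> (A *v v)"
    using continuous_attains_sup by metis
  define l where "l = v \<bullet> (A *v v)"
  have nv: "v \<in> V" "norm v = 1" using v(1) by (auto simp: S_def)
  have le: "u \<bullet> (A *v u) \<le> l * (norm u)\<^sup>2" if "u \<in> V" for u
  proof (cases "u = 0")
    case False
    then have "(1 / norm u) *\<^sub>R u \<in> S" unfolding S_def
      using V(1) that by (auto simp: subspace_scale)
    from v(2)[OF this] show ?thesis
      using False by (simp add: l_def matrix_vector_mult_scaleR power2_eq_square divide_simps)
  qed simp
  \<comment> \<open>The residual of the eigenvalue equation is used as the direction of variation.
    Perturbing the maximizer by \<open>t *\<^sub>R w\<close> gains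
    \<open>2 * t * (norm w)\<^sup>2\<close> to first order, and maximality leaves only a term of
    second order in \<open>t\<close> to balance it.\<close>
  define w where "w = A *v v - l *\<^sub>R v"
  have wV: "w \<in> V" unfolding w_def using nv V by (simp add: subspace_diff subspace_scale)
  define c where "c = l * (norm w)\<^sup>2 - w \<bullet> (A *v w)"
  have key: "2 * t * (norm w)\<^sup>2 \<le> t\<^sup>2 * c" for t :: real
  proof -
    have "v + t *\<^sub>R w \<in> V" using nv wV V by (simp add: subspace_add subspace_scale)
    from le[OF this] have
      "(v + t *\<^sub>R w) \<bullet> (A *v (v + t *\<^sub>R w)) \<le> l * ((v + t *\<^sub>R w) \<bullet> (v + t *\<^sub>R w))"
      by (simp add: power2_norm_eq_inner)
    moreover have  "(v + t *\<^sub>R w) \<bullet> (A *v (v + t *\<^sub>R w)) = l + 2 * t * (w \<bullet> (A *v v)) + t\<^sup>2 * (w \<bullet> (A *v w))"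
    proof -
      have "v \<bullet> (A *v w) = w \<bullet> (A *v v)" by (metis sym inner_commute)
      then show ?thesis
        by (simp add: matrix_vector_right_distrib matrix_vector_mult_scaleR inner_add_left
            inner_add_right l_def power2_eq_square algebra_simps)
    qed
    moreover have "(v + t *\<^sub>R w) \<bullet> (v + t *\<^sub>R w) = 1 + 2 * t * (w \<bullet> v) + t\<^sup>2 * (norm w)\<^sup>2"
      using nv unfolding power2_norm_eq_inner norm_eq_1
      by (simp add: inner_add_left inner_add_right power2_eq_square algebra_simps
          inner_commute[of v w])
    ultimately have "l + 2 * t * (w \<bullet> (A *v v)) + t\<^sup>2 * (w \<bullet> (A *v w)) \<le> l * (1 + 2 * t * (w \<bullet> v) + t\<^sup>2 * (norm w)\<^sup>2)"
      by (simp only:)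
    moreover have "2 * t * (norm w)\<^sup>2 = 2 * t * (w \<bullet> (A *v v)) - 2 * t * (l * (w \<bullet> v))"
      unfolding power2_norm_eq_inner by (subst (2) w_def) (simp add: inner_diff_right algebra_simps)
    ultimately show ?thesis
      by (simp add: c_def algebra_simps)
  qed
  have "norm w = 0"
  proof (rule ccontr)
    assume "norm w \<noteq> 0"
    then have w2: "0 < (norm w)\<^sup>2" by simp
    \<comment> \<open>With this step length \<open>t * c\<close> is at most
      \<open>(norm w)\<^sup>2\<close>, half of what the inequality \<open>key\<close>
      demands.\<close>
    define t where "t = (norm w)\<^sup>2 / (\<bar>c\<bar> + 1)"
    have t: "0 < t" unfolding t_def using w2 by (intro divide_pos_pos) auto
    have "t * (2 * (norm w)\<^sup>2) \<le> t * (t * c)"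
      using key[of t] by (simp add: power2_eq_square algebra_simps)
    then have "2 * (norm w)\<^sup>2 \<le> t * c" using t by simp
    also have "\<dots> \<le> t * (\<bar>c\<bar> + 1)" using t by (intro mult_left_mono) auto
    also have "\<dots> = (norm w)\<^sup>2" unfolding t_def by (simp add: nonzero_divide_eq_eq)
    finally show False using w2 by simp
  qed
  then have "A *v v = l *\<^sub>R v" by (simp add: w_def)
  with nv show thesis by (rule that)
qed

definition orthonormal :: "(complex^'m) set \<Rightarrow> bool" where
  "orthonormal S \<longleftrightarrow> (\<forall>u\<in>S. \<forall>v\<in>S. hermitian_prod u v = (if u = v then 1 else 0))"

lemma orthonormal_independent:
  assumes "orthonormal S"
  shows "vec.independent S"
proof -
  have False if T: "finite T" "T \<subseteq> S" "(\<Sum>v\<in>T. u v *s v) = 0" "v \<in> T" "u v \<noteq> 0" for T u v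
  proof -
    have "0 = hermitian_prod v (\<Sum>v\<in>T. u v *s v)" using T by (simp add: hermitian_prod_simps)
    also have "\<dots> = (\<Sum>x\<in>T. u x * hermitian_prod v x)"
      by (simp add: hermitian_prod_sum hermitian_prod_simps)
    also have "\<dots> = (\<Sum>x\<in>T. if x = v then u x else 0)"
      using T assms by (intro sum.cong) (auto simp: orthonormal_def subset_iff)
    also have "\<dots> = u v" using T by simp
    finally show False using T by simp
  qed
  then show ?thesis unfolding vec.dependent_explicit by blast
qed

lemma diag_mat_mult_entry:
  fixes X :: "complex^'m^'m"
  shows "(diag_mat k ** X) $ i $ j = of_real (k i) * X $ i $ j"
    and "(X ** diag_mat k) $ i $ j = X $ i $ j * of_real (k j)"
proof -
  have "(diag_mat k ** X) $ i $ j = (\<Sum>n\<in>UNIV. if n = i then of_real (k i) * X $ i $ j else 0)"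
    by (subst matrix_matrix_mult_def, subst vec_lambda_beta, subst vec_lambda_beta, intro sum.cong)
      (auto simp: diag_mat_def)
  then show "(diag_mat k ** X) $ i $ j = of_real (k i) * X $ i $ j" by simp
  have "(X ** diag_mat k) $ i $ j = (\<Sum>n\<in>UNIV. if n = j then X $ i $ j * of_real (k j) else 0)"
    by (subst matrix_matrix_mult_def, subst vec_lambda_beta, subst vec_lambda_beta, intro sum.cong)
      (auto simp: diag_mat_def)
  then show "(X ** diag_mat k) $ i $ j = X $ i $ j * of_real (k j)" by simp
qed

text \<open>An orthonormal set of eigenvectors of maximal cardinality exists because the dimension
  bounds the cardinality. Its orthogonal complement is invariant under \<open>A\<close>, so a
  nonzero vector there would yield one more unit eigenvector. Hence the set is a basis, and its
  members are the columns of \<open>U\<close>.\<close>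

theorem hermitian_diagonalization:
  fixes A :: "complex^'m^'m"
  assumes A: "conj_transpose A = A"
  obtains U l where "unitary_mat U" "A = U ** diag_mat l ** conj_transpose U"
proof -
  define P where "P S \<longleftrightarrow> orthonormal S \<and> (\<forall>v\<in>S. \<exists>l. A *v v = l *\<^sub>R v)" for S :: "(complex^'m) set"
  have card_le: "finite S \<and> card S \<le> CARD('m)" if "P S" for S
    using vec.independent_bound_general[OF orthonormal_independent, of S] that
      vec.dim_subset_UNIV[of S]
    by (auto simp: P_def vec.dimension_def card_cart_basis)
  have "P {}" by (simp add: P_def orthonormal_def)
  then obtain S where S: "P S" "\<And>T. P T \<Longrightarrow> card T \<le> card S"
    using ex_has_greatest_nat[of P "{}" card "CARD('m) + 1"] card_le by fastforce
  have on: "orthonormal S" and ev: "\<And>v. v \<in> S \<Longrightarrow> \<exists>l. A *v v = l *\<^sub>R v"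
    and fin: "finite S" using S card_le by (auto simp: P_def)
  define V where "V = {v. \<forall>e\<in>S. hermitian_prod e v = 0}"
  have V0: "v = 0" if "v \<in> V" for v
  proof (rule ccontr)
    assume "v \<noteq> 0"
    have "subspace V"
      by (auto simp: subspace_def V_def hermitian_prod_simps)
    moreover have "A *v v \<in> V" if "v \<in> V" for v
    proof -
      have "hermitian_prod e (A *v v) = 0" if e: "e \<in> S" for e
      proof -
        obtain l where "A *v e = l *\<^sub>R e" using ev[OF e] by blast
        then have "hermitian_prod e (A *v v) = hermitian_prod (l *\<^sub>R e) v"
          using hermitian_prod_conj_transpose[of A e v] A by simp
        also have "\<dots> = cnj (hermitian_prod v (l *\<^sub>R e))" by (simp add: cnj_hermitian_prod)
        also have "\<dots> = l * hermitian_prod e v"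
          by (simp add: hermitian_prod_simps cnj_hermitian_prod)
        finally show ?thesis using \<open>v \<in> V\<close> e by (simp add: V_def)
      qed
      then show ?thesis by (simp add: V_def)
    qed
    ultimately obtain w l where w: "w \<in> V" "norm w = 1" "A *v w = l *\<^sub>R w"
      using self_adjoint_eigenvector_in_invariant_subspace[OF A] \<open>v \<in> V\<close> \<open>v \<noteq> 0\<close> by metis
    have ww: "hermitian_prod w w = 1" using w by (simp add: hermitian_prod_self)
    then have "w \<notin> S" using w(1) by (auto simp: V_def)
    have "hermitian_prod w e = 0" if "e \<in> S" for e
      using w(1) that cnj_hermitian_prod[of e w] by (simp add: V_def)
    then have "P (insert w S)"
      using S(1) w ww by (auto simp: P_def orthonormal_def V_def)
    from S(2)[OF this] show False using \<open>w \<notin> S\<close> fin by simp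
  qed
  have span: "v \<in> vec.span S" for v
  proof -
    have "hermitian_prod e (v - (\<Sum>x\<in>S. hermitian_prod x v *s x)) = 0" if e: "e \<in> S" for e
    proof -
      have "hermitian_prod e (\<Sum>x\<in>S. hermitian_prod x v *s x) = (\<Sum>x\<in>S. if x = e then hermitian_prod x v else 0)"
        unfolding hermitian_prod_sum hermitian_prod_simps
        using on e by (intro sum.cong) (auto simp: orthonormal_def)
      then show ?thesis using e fin by (simp add: hermitian_prod_simps)
    qed
    then have "v = (\<Sum>x\<in>S. hermitian_prod x v *s x)" using V0 by (force simp: V_def)
    then show ?thesis
      by (metis (no_types, lifting) vec.span_sum vec.span_scale vec.span_base)
  qed
  have "card S = vec.dim (UNIV :: (complex^'m) set)"
    using span by (intro vec.dim_eq_card[symmetric] orthonormal_independent on) (auto simp: vec.span_UNIV)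
  then have "card S = CARD('m)" by (simp add: vec.dim_UNIV vec.dimension_def card_cart_basis)
  then obtain h where h: "bij_betw h (UNIV :: 'm set) S"
    using fin finite_same_card_bij[of "UNIV :: 'm set" S] by auto
  then have hS: "h i \<in> S" for i by (auto simp: bij_betw_def)
  obtain l where l: "A *v h i = l i *\<^sub>R h i" for i
    using ev[OF hS] by metis
  define U :: "complex^'m^'m" where "U = (\<chi> i j. h j $ i)"
  have hh: "hermitian_prod (h i) (h j) = (if i = j then 1 else 0)" for i j
    using on hS h by (auto simp: orthonormal_def bij_betw_def inj_eq)
  have UU: "conj_transpose U ** U = mat 1"
    by (simp add: vec_eq_iff matrix_matrix_mult_def conj_transpose_def U_def mat_def
        hh[unfolded hermitian_prod_def])
  then have UU': "U ** conj_transpose U = mat 1"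
    by (simp add: matrix_left_right_inverse)
  have AU: "A ** U = U ** diag_mat l"
  proof -
    have "(A ** U) $ i $ j = (U ** diag_mat l) $ i $ j" for i j
    proof -
      have "(A ** U) $ i $ j = (A *v h j) $ i"
        by (simp add: matrix_matrix_mult_def matrix_vector_mult_def U_def)
      also have "\<dots> = (U ** diag_mat l) $ i $ j"
        by (simp add: l U_def diag_mat_mult_entry scaleR_conv_of_real[where 'a=complex])
      finally show ?thesis .
    qed
    then show ?thesis by (simp add: vec_eq_iff)
  qed
  have "A = A ** (U ** conj_transpose U)" by (simp add: UU')
  also have "\<dots> = U ** diag_mat l ** conj_transpose U" by (simp add: matrix_mul_assoc AU)
  finally show thesis using UU UU' by (intro that[of U l]) (auto simp: unitary_mat_def)
qed

section \<open>Calculus and measurability of spectral powers\<close>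

text \<open>This resolves the definite description in \<open>mat_powr\<close>, so that any
  diagonalization at hand may be used. The value is unique because an entry of the intertwining
  matrix vanishes unless the two eigenvalues it connects are equal, and equal eigenvalues have equal
  powers.\<close>

lemma mat_powr_eq:
  fixes A :: "complex^'m^'m"
  assumes U: "unitary_mat U" and A: "A = U ** diag_mat l ** conj_transpose U"
  shows "mat_powr A r = U ** diag_mat (\<lambda>i. l i powr r) ** conj_transpose U"
  unfolding mat_powr_def
proof (rule the_equality)
  show "\<exists>U' l'. unitary_mat U' \<and> A = U' ** diag_mat l' ** conj_transpose U' \<and>
    U ** diag_mat (\<lambda>i. l i powr r) ** conj_transpose U = U' ** diag_mat (\<lambda>i. l' i powr r) ** conj_transpose U'"
    using U A by blast
next
  fix B
  assume "\<exists>U' l'. unitary_mat U' \<and> A = U' ** diag_mat l' ** conj_transpose U' \<and>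
    B = U' ** diag_mat (\<lambda>i. l' i powr r) ** conj_transpose U'"
  then obtain U' l' where U': "unitary_mat U'" and A': "A = U' ** diag_mat l' ** conj_transpose U'"
    and B: "B = U' ** diag_mat (\<lambda>i. l' i powr r) ** conj_transpose U'" by blast
  \<comment> \<open>The unitary \<open>V\<close> intertwines both diagonal matrices, hence also any function of them.\<close>
  define V where "V = conj_transpose U' ** U"
  have inv: "conj_transpose U' ** U' = mat 1" "U' ** conj_transpose U' = mat 1"
    "conj_transpose U ** U = mat 1" "U ** conj_transpose U = mat 1"
    using U U' by (auto simp: unitary_mat_def)
  have "conj_transpose U' ** A ** U = diag_mat l' ** V"
    unfolding A' V_def by (simp add: matrix_mul_assoc inv)
  moreover have "conj_transpose U' ** A ** U = V ** diag_mat l"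
    unfolding A V_def by (simp add: inv flip: matrix_mul_assoc)
  ultimately have VD: "diag_mat l' ** V = V ** diag_mat l" by simp
  have "of_real (l' i) * V $ i $ j = V $ i $ j * of_real (l j)" for i j
    using VD by (metis diag_mat_mult_entry)
  then have "V $ i $ j = 0 \<or> l' i = l j" for i j
    by (metis mult.commute mult_cancel_left of_real_eq_iff)
  then have "of_real (l' i powr r) * V $ i $ j = V $ i $ j * of_real (l j powr r)" for i j
    by (metis mult.commute mult_zero_left)
  then have VD': "diag_mat (\<lambda>i. l' i powr r) ** V = V ** diag_mat (\<lambda>i. l i powr r)"
    by (simp add: vec_eq_iff diag_mat_mult_entry)
  have "B = U' ** (diag_mat (\<lambda>i. l' i powr r) ** V) ** conj_transpose U"
    unfolding B V_def by (simp add: inv flip: matrix_mul_assoc)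
  also have "\<dots> = U ** diag_mat (\<lambda>i. l i powr r) ** conj_transpose U"
    unfolding VD' unfolding V_def by (simp add: inv matrix_mul_assoc)
  finally show "B = U ** diag_mat (\<lambda>i. l i powr r) ** conj_transpose U" .
qed

lemma diag_mat_mult: "diag_mat k ** diag_mat l = diag_mat (\<lambda>i. k i * l i)"
  unfolding vec_eq_iff diag_mat_mult_entry by (simp add: diag_mat_def)

lemma diag_mat_one: "diag_mat (\<lambda>i. 1) = mat 1"
  by (simp add: diag_mat_def mat_def vec_eq_iff)

lemma diag_mat_axis: "diag_mat l *v axis i 1 = l i *\<^sub>R axis i 1"
proof -
  have "(diag_mat l *v v) $ k = of_real (l k) * v $ k" for v k
  proof -
    have "(diag_mat l *v v) $ k = (\<Sum>n\<in>UNIV. if n = k then of_real (l k) * v $ k else 0)"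
      by (subst matrix_vector_mult_def, subst vec_lambda_beta, intro sum.cong) (auto simp: diag_mat_def)
    then show ?thesis by simp
  qed
  then show ?thesis by (simp add: vec_eq_iff axis_def scaleR_conv_of_real[where 'a=complex])
qed

lemma nonneg_definite_diagonalization:
  assumes "nonneg_definite A"
  obtains U l where "unitary_mat U" "A = U ** diag_mat l ** conj_transpose U" "\<And>i. 0 \<le> l i"
proof -
  have "conj_transpose A = A" using assms by (simp add: nonneg_definite_def)
  then obtain U l where U: "unitary_mat U" and A: "A = U ** diag_mat l ** conj_transpose U"
    by (rule hermitian_diagonalization)
  have "0 \<le> l i" for i
  proof -
    \<comment> \<open>This column of \<open>U\<close> is an eigenvector for \<open>l i\<close>, so
      the sign of the quadratic form at \<open>v\<close> is that of \<open>l i\<close>.\<close>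
    define v where "v = U *v axis i 1"
    have "A *v v = U *v (diag_mat l *v ((conj_transpose U ** U) *v axis i 1))"
      by (simp add: A v_def matrix_vector_mul_assoc matrix_mul_assoc)
    also have "conj_transpose U ** U = mat 1" using U by (simp add: unitary_mat_def)
    also have "diag_mat l *v (mat 1 *v axis i 1) = l i *\<^sub>R axis i 1"
      by (simp add: diag_mat_axis)
    finally have Av: "A *v v = l i *\<^sub>R v" by (simp add: v_def matrix_vector_mult_scaleR)
    have "v \<noteq> 0"
    proof
      assume "v = 0"
      then have "conj_transpose U *v v = 0" by simp
      then have "axis i (1::complex) = 0" using U
        by (simp add: v_def matrix_vector_mul_assoc unitary_mat_def)
      then show False by simp
    qed
    moreover have "0 \<le> l i * (norm v)\<^sup>2"
      using assms unfolding nonneg_definite_def quad_form_hermitian_prod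
      by (metis Av Re_hermitian_prod inner_scaleR_right power2_norm_eq_inner)
    ultimately show ?thesis by (simp add: zero_le_mult_iff)
  qed
  with U A show thesis by (rule that)
qed

lemma unitary_conjugate_mult:
  assumes "unitary_mat U"
  shows "(U ** X ** conj_transpose U) ** (U ** Y ** conj_transpose U) = U ** (X ** Y) ** conj_transpose U"
proof -
  have "(U ** X ** conj_transpose U) ** (U ** Y ** conj_transpose U) =
      U ** X ** (conj_transpose U ** U) ** Y ** conj_transpose U"
    by (simp add: matrix_mul_assoc)
  also have "conj_transpose U ** U = mat 1" using assms by (simp add: unitary_mat_def)
  finally show ?thesis by (simp add: matrix_mul_assoc)
qed

text \<open>Invertibility excludes zero eigenvalues. At these, \<open>0 powr r = 0\<close> for every
  \<open>r\<close>, and the product of the two powers would be 0 instead of 1.\<close>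

lemma mat_powr_minus_inverse:
  assumes A: "nonneg_definite A" "invertible A"
  shows "mat_powr A (- r) ** mat_powr A r = mat 1"
proof -
  obtain U l where U: "unitary_mat U" and Ad: "A = U ** diag_mat l ** conj_transpose U"
    using nonneg_definite_diagonalization[OF A(1)] by metis
  have inv: "conj_transpose U ** U = mat 1" "U ** conj_transpose U = mat 1"
    using U by (auto simp: unitary_mat_def)
  have "l i \<noteq> 0" for i
  proof
    assume "l i = 0"
    then have "diag_mat l *v axis i (1 :: complex) = 0"
      by (simp add: diag_mat_axis)
    have "A *v (U *v axis i 1) = U *v (diag_mat l *v ((conj_transpose U ** U) *v axis i 1))"
      by (simp add: Ad matrix_vector_mul_assoc matrix_mul_assoc)
    then have "A *v (U *v axis i 1) = 0"
      using \<open>diag_mat l *v axis i 1 = 0\<close> by (simp add: inv)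
    moreover obtain B where "B ** A = mat 1" using A(2) by (auto simp: invertible_def)
    ultimately have "U *v axis i 1 = 0"
      by (metis matrix_vector_mul_assoc matrix_vector_mul_lid matrix_vector_mult_0_right)
    then have "axis i (1::complex) = 0"
      using inv(1) by (metis matrix_vector_mul_assoc matrix_vector_mul_lid matrix_vector_mult_0_right)
    then show False by simp
  qed
  then have "diag_mat (\<lambda>i. l i powr (-r)) ** diag_mat (\<lambda>i. l i powr r) = mat 1"
    by (simp add: diag_mat_mult powr_minus diag_mat_one)
  moreover have "mat_powr A (- r) ** mat_powr A r =
    U ** (diag_mat (\<lambda>i. l i powr (-r)) ** diag_mat (\<lambda>i. l i powr r)) ** conj_transpose U"
    unfolding mat_powr_eq[OF U Ad] by (rule unitary_conjugate_mult[OF U])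
  ultimately show ?thesis by (simp add: inv)
qed

lemma norm_le_op_norm: "norm (A *v v) \<le> op_norm A * norm v"
  unfolding op_norm_def by (intro onorm bounded_linear_matrix_vector_mult_complex)

lemma op_norm_nonneg: "0 \<le> op_norm A"
  unfolding op_norm_def by (intro onorm_pos_le bounded_linear_matrix_vector_mult_complex)

lemma pos_definite_bounded_below:
  assumes "pos_definite A"
  obtains c where "0 < c" "\<And>v. c * norm v \<le> norm (A *v v)"
proof -
  have "v = 0" if "A *v v = 0" for v
    using assms that by (force simp: pos_definite_def quad_form_def)
  then have "inj ((*v) A)"
    using linear_injective_0[OF bounded_linear.linear[OF bounded_linear_matrix_vector_mult_complex]] by blast
  then obtain c where "c > 0" "\<And>x. norm (A *v x) \<ge> c * norm x"
    using linear_inj_bounded_below_pos[of "(*v) A"] bounded_linear_matrix_vector_mult_complex[of A]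
    by (auto simp: bounded_linear.linear mult.commute)
  then show thesis by (rule that)
qed

text \<open>By Weierstrass approximation, spectral functions of a measurable family of matrices are
  limits of polynomials in these matrices.\<close>

lemma mat_powr_measurable:
  fixes W :: "'a \<Rightarrow> complex^'m^'m"
  assumes W: "\<And>x. nonneg_definite (W x)" and meas: "\<And>i j. (\<lambda>x. W x $ i $ j) \<in> borel_measurable M"
    and r: "0 < r"
  shows "(\<lambda>x. mat_powr (W x) r $ i $ j) \<in> borel_measurable M"
proof -
  \<comment> \<open>These choices are made point by point and carry no measurability in
    \<open>x\<close>. It is recovered from \<open>S \<phi> x\<close>, which for polynomial
    \<open>\<phi>\<close> is a polynomial in the matrix \<open>W x\<close>.\<close>
  obtain U l where U: "\<And>x. unitary_mat (U x)" and Wd: "\<And>x. W x = U x ** diag_mat (l x) ** conj_transpose (U x)"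
    and l: "\<And>x i. 0 \<le> l x i"
  proof -
    have "\<forall>x. \<exists>U l. unitary_mat U \<and> W x = U ** diag_mat l ** conj_transpose U \<and> (\<forall>i. 0 \<le> l i)"
      using nonneg_definite_diagonalization[OF W] by metis
    then show thesis using that by metis
  qed
  have inv: "conj_transpose (U x) ** U x = mat 1" "U x ** conj_transpose (U x) = mat 1" for x
    using U by (auto simp: unitary_mat_def)
  define S where "S \<phi> x = U x ** diag_mat (\<lambda>i. \<phi> (l x i)) ** conj_transpose (U x)" for \<phi> x
  have S_entry: "S \<phi> x $ i $ j = (\<Sum>k\<in>UNIV. U x $ i $ k * of_real (\<phi> (l x k)) * cnj (U x $ j $ k))" for \<phi> x i j
  proof -
    show ?thesis
      unfolding S_def by (subst matrix_matrix_mult_def) (simp add: conj_transpose_def diag_mat_mult_entry)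
  qed
  have poly: "(\<lambda>x. S \<phi> x $ i $ j) \<in> borel_measurable M" if "real_polynomial_function \<phi>" for \<phi> i j
    using that
  proof (induction \<phi> arbitrary: i j rule: real_polynomial_function.induct)
    case (linear \<phi>)
    then obtain c where "\<phi> = (\<lambda>t. t * c)" by (auto simp: real_bounded_linear)
    then have "S \<phi> x $ i $ j = of_real c * W x $ i $ j" for x
      using S_entry[of "\<lambda>t. t" x i j] by (simp add: S_entry S_def[of "\<lambda>t. t"] sum_distrib_left mult_ac Wd)
    then show ?case using meas by simp
  next
    case (const c)
    have "S (\<lambda>t. c) x $ i $ j = of_real c * (U x ** conj_transpose (U x)) $ i $ j" for x
      by (simp add: S_entry matrix_matrix_mult_def conj_transpose_def sum_distrib_left mult_ac)
    then show ?case by (simp add: inv)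
  next
    case (add f g)
    have "S (\<lambda>t. f t + g t) x $ i $ j = S f x $ i $ j + S g x $ i $ j" for x
      by (simp add: S_entry algebra_simps sum.distrib)
    then show ?case using add by simp
  next
    case (mult f g)
    have "S (\<lambda>t. f t * g t) x = S f x ** S g x" for x
      unfolding S_def diag_mat_mult[symmetric] by (rule unitary_conjugate_mult[OF U, symmetric])
    then have "S (\<lambda>t. f t * g t) x $ i $ j = (\<Sum>k\<in>UNIV. S f x $ i $ k * S g x $ k $ j)" for x
      by (simp add: matrix_matrix_mult_def)
    then show ?case using mult by simp
  qed
  \<comment> \<open>The interval grows while the error shrinks, so that one sequence of polynomials
    converges at every nonnegative \<open>t\<close>, with no bound on the eigenvalues.\<close>
  have "\<exists>\<phi>. real_polynomial_function \<phi> \<and> (\<forall>t\<in>{0..real n}. \<bar>t powr r - \<phi> t\<bar> < 1 / Suc n)" for n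
    by (rule Stone_Weierstrass_real_polynomial_function[of "{0..real n}" "\<lambda>t. t powr r" "1 / Suc n"])
      (use r in \<open>auto intro!: continuous_intros continuous_on_powr'\<close>)
  then obtain \<phi> where \<phi>: "\<And>n. real_polynomial_function (\<phi> n)"
    "\<And>n t. t \<in> {0..real n} \<Longrightarrow> \<bar>t powr r - \<phi> n t\<bar> < 1 / Suc n" by metis
  have lim: "(\<lambda>n. \<phi> n t) \<longlonglongrightarrow> t powr r" if "0 \<le> t" for t
  proof (rule LIM_zero_cancel)
    obtain N where N: "t \<le> real N" using real_arch_simple by blast
    show "(\<lambda>n. \<phi> n t - t powr r) \<longlonglongrightarrow> 0"
    proof (rule Lim_null_comparison)
      show "\<forall>\<^sub>F n in sequentially. norm (\<phi> n t - t powr r) \<le> 1 / Suc n"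
        unfolding eventually_sequentially
      proof (intro exI allI impI)
        fix n assume "N \<le> n"
        then show "norm (\<phi> n t - t powr r) \<le> 1 / Suc n" using \<phi>(2)[of t n] N that by force
      qed
      show "(\<lambda>n. 1 / real (Suc n)) \<longlonglongrightarrow> 0" by (rule LIMSEQ_Suc[OF lim_1_over_n])
    qed
  qed
  have "(\<lambda>x. S (\<lambda>t. t powr r) x $ i $ j) \<in> borel_measurable M"
  proof (rule borel_measurable_LIMSEQ_metric)
    show "(\<lambda>x. S (\<phi> n) x $ i $ j) \<in> borel_measurable M" for n using poly \<phi>(1) by blast
    show "(\<lambda>n. S (\<phi> n) x $ i $ j) \<longlonglongrightarrow> S (\<lambda>t. t powr r) x $ i $ j" for x
      unfolding S_entry by (intro tendsto_intros lim l)
  qed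
  then show ?thesis by (simp add: S_def mat_powr_eq[OF U Wd])
qed

section \<open>Integrability from oscillation bounds\<close>

text \<open>After division by \<open>a + b\<close> this is \<open>t \<le> t powr p\<close> on the
  unit interval. For exponents at most 1 it provides the triangle inequality for p-th powers of
  norms.\<close>

lemma powr_add_subadditive:
  fixes a b p :: real
  assumes "0 \<le> a" "0 \<le> b" "0 < p" "p \<le> 1"
  shows "(a + b) powr p \<le> a powr p + b powr p"
proof (cases "a + b = 0")
  case False
  then have ab: "0 < a + b" using assms by simp
  have *: "t / (a + b) \<le> (t / (a + b)) powr p" if "0 \<le> t" "t \<le> a + b" for t
    using powr_mono'[of p 1 "t / (a + b)"] that ab assms by (cases "t = 0") auto
  have "1 = a / (a + b) + b / (a + b)" using ab by (simp flip: add_divide_distrib)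
  also have "\<dots> \<le> (a / (a + b)) powr p + (b / (a + b)) powr p"
    using * assms by (intro add_mono) auto
  also have "\<dots> = (a powr p + b powr p) / (a + b) powr p"
    using assms by (simp add: powr_divide add_divide_distrib)
  finally show ?thesis using ab by (simp add: pos_le_divide_eq)
qed (use assms in auto)

lemma norm_diff_powr_le:
  assumes "0 < p" "p \<le> 1"
  shows "norm (a :: 'b :: real_normed_vector) powr p \<le> norm (a - b) powr p + norm b powr p"
proof -
  have "norm a powr p \<le> (norm (a - b) + norm b) powr p"
    using assms norm_triangle_ineq[of "a - b" b] by (intro powr_mono2) auto
  also have "\<dots> \<le> norm (a - b) powr p + norm b powr p"
    using assms by (intro powr_add_subadditive) auto
  finally show ?thesis .
qed

lemma ennreal_le_suminf: "(f :: nat \<Rightarrow> ennreal) n \<le> suminf f"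
  using sum_le_suminf[of f "{n}"] by simp

text \<open>Otherwise \<open>g\<close> would exceed \<open>t\<close> almost everywhere on
  \<open>A\<close>, and its integral would be at least \<open>t * emeasure M A\<close>. It supplies
  the good points of the chaining argument, off a given null set.\<close>

lemma exists_le_average:
  assumes A: "A \<in> sets M" and N: "N \<in> null_sets M" and g: "g \<in> borel_measurable M"
    and less: "(\<integral>\<^sup>+x. g x \<partial>M) < t * emeasure M A"
  shows "\<exists>y\<in>A - N. g y \<le> t"
proof (rule ccontr)
  assume "\<not> ?thesis"
  then have "t * indicator (A - N) x \<le> g x" for x by (auto simp: indicator_def not_le less_imp_le)
  then have "(\<integral>\<^sup>+x. t * indicator (A - N) x \<partial>M) \<le> (\<integral>\<^sup>+x. g x \<partial>M)" by (intro nn_integral_mono)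
  moreover have "A - N \<in> sets M" using A N by auto
  ultimately show False
    using less A N by (simp add: nn_integral_cmult_indicator emeasure_Diff_null_set)
qed

section \<open>Quasi-metric balls and doubling\<close>

context homogeneous_space
begin

lemma qball_mono: "r \<le> R \<Longrightarrow> qball d x r \<subseteq> qball d x R"
  by (auto simp: qball_def)

lemma qball_subset:
  assumes "A0 * (d x y + r) \<le> R"
  shows "qball d y r \<subseteq> qball d x R"
proof
  fix u assume "u \<in> qball d y r"
  then have "d y u < r" by (simp add: qball_def)
  have "d x u \<le> A0 * (d x y + d y u)" by (rule d_quasi_triangle)
  also have "\<dots> < A0 * (d x y + r)"
    using \<open>d y u < r\<close> A0_ge_1 by (intro mult_strict_left_mono) auto
  finally show "u \<in> qball d x R" using assms by (simp add: qball_def)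
qed

lemma qball_dist_less:
  assumes "y \<in> qball d x r" "u \<in> qball d x R"
  shows "d y u < A0 * (r + R)"
proof -
  have "d y u \<le> A0 * (d y x + d x u)" by (rule d_quasi_triangle)
  also have "\<dots> < A0 * (r + R)"
    using assms A0_ge_1 d_commute[of y x] by (intro mult_strict_left_mono) (auto simp: qball_def)
  finally show ?thesis .
qed

lemma center_in_qball: "0 < r \<Longrightarrow> x \<in> qball d x r"
  using d_eq_0_iff[of x x] by (simp add: qball_def)

lemma emeasure_qball: "0 < r \<Longrightarrow> emeasure M (qball d x r) = ennreal (measure M (qball d x r))"
  using qball_finite[of r x] by (simp add: emeasure_eq_ennreal_measure)

lemma measure_qball_pos: "0 < r \<Longrightarrow> 0 < measure M (qball d x r)"
  using qball_pos[of r x] emeasure_qball[of r x] by simp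

lemma measure_qball_mono: "S \<in> sets M \<Longrightarrow> S \<subseteq> qball d x r \<Longrightarrow> 0 < r \<Longrightarrow> measure M S \<le> measure M (qball d x r)"
  using qball_finite[of r x] by (intro measure_mono_fmeasurable) (auto simp: fmeasurable_def qball_sets)

text \<open>The set whose infimum is \<open>doubling_const d M\<close>.\<close>

definition doubling_bounds :: "real set" where
  "doubling_bounds = {C. 1 \<le> C \<and>
     (\<forall>x r. 0 < r \<longrightarrow> measure M (qball d x (2 * r)) \<le> C * measure M (qball d x r))}"

lemma doubling_bounds_nonempty: "doubling_bounds \<noteq> {}"
proof -
  obtain C where C: "\<And>x r. 0 < r \<Longrightarrow> measure M (qball d x (2 * r)) \<le> C * measure M (qball d x r)"
    using doubling by blast
  have "measure M (qball d x (2 * r)) \<le> max 1 C * measure M (qball d x r)" if "0 < r" for x r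
    by (rule order_trans[OF C[OF that]]) (intro mult_right_mono, auto)
  then have "max 1 C \<in> doubling_bounds" by (auto simp: doubling_bounds_def)
  then show ?thesis by blast
qed

lemma doubling_const_ge_1: "1 \<le> doubling_const d M"
  unfolding doubling_const_def
  using doubling_bounds_nonempty unfolding doubling_bounds_def by (intro cInf_greatest) auto

lemma upper_dim_nonneg: "0 \<le> upper_dim d M"
  unfolding upper_dim_def using doubling_const_ge_1 by simp

text \<open>The upper dimension is the logarithm of an infimum. A strictly larger \<open>D\<close>
  leaves room for an admissible doubling constant below \<open>2 powr D\<close>, whether or not the
  infimum is attained.\<close>

lemma measure_qball_double:
  assumes D: "upper_dim d M < D" and r: "0 < r"
  shows "measure M (qball d x (2 * r)) \<le> 2 powr D * measure M (qball d x r)"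
proof -
  have "Inf doubling_bounds < 2 powr D"
    using D doubling_const_ge_1
    unfolding upper_dim_def by (simp add: log_less_iff doubling_const_def doubling_bounds_def)
  then obtain C where C: "C \<in> doubling_bounds" "C < 2 powr D"
    using cInf_lessD[OF doubling_bounds_nonempty] by blast
  have "measure M (qball d x (2 * r)) \<le> C * measure M (qball d x r)"
    using C r by (auto simp: doubling_bounds_def)
  also have "\<dots> \<le> 2 powr D * measure M (qball d x r)"
    using C by (intro mult_right_mono) auto
  finally show ?thesis .
qed

text \<open>Doubling is iterated up to the first power of 2 that is at least \<open>t\<close>. This
  power is at most \<open>2 * t\<close>, which accounts for the factor
  \<open>2 powr D\<close>.\<close>

lemma measure_qball_scale:
  assumes D: "upper_dim d M < D" and r: "0 < r" and t: "1 \<le> t"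
  shows "measure M (qball d x (t * r)) \<le> 2 powr D * t powr D * measure M (qball d x r)"
proof -
  have D0: "0 < D" using D upper_dim_nonneg by simp
  have iter: "measure M (qball d x (2 ^ n * r)) \<le> (2 powr D) ^ n * measure M (qball d x r)" for n
  proof (induction n)
    case (Suc n)
    have "measure M (qball d x (2 ^ Suc n * r)) \<le> 2 powr D * measure M (qball d x (2 ^ n * r))"
      using measure_qball_double[OF D, of "2 ^ n * r"] r by (simp add: mult_ac)
    also have "\<dots> \<le> 2 powr D * ((2 powr D) ^ n * measure M (qball d x r))"
      using Suc by (intro mult_left_mono) auto
    finally show ?case by (simp add: mult_ac)
  qed simp
  define n where "n = nat \<lceil>log 2 t\<rceil>"
  have l0: "0 \<le> log 2 t" using t by simp
  have n: "log 2 t \<le> n" "n \<le> 1 + log 2 t" unfolding n_def using l0 by linarith+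
  have "t = 2 powr log 2 t" using t by simp
  also have "\<dots> \<le> 2 powr n" using n by (intro powr_mono) auto
  finally have tn: "t \<le> 2 ^ n" by (simp add: powr_realpow)
  have "(2::real) powr n \<le> 2 powr (1 + log 2 t)" using n by (intro powr_mono) auto
  then have nt: "(2::real) ^ n \<le> 2 * t" using t by (simp add: powr_realpow powr_add)
  have "measure M (qball d x (t * r)) \<le> measure M (qball d x (2 ^ n * r))"
    using tn r by (intro measure_qball_mono qball_mono qball_sets) auto
  also have "\<dots> \<le> (2 powr D) ^ n * measure M (qball d x r)" by (rule iter)
  also have "(2 powr D) ^ n = (2 ^ n) powr D"
    by (simp add: powr_powr mult.commute flip: powr_realpow)
  also have "(2 ^ n) powr D * measure M (qball d x r) \<le> (2 * t) powr D * measure M (qball d x r)"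
    using nt D0 by (intro mult_right_mono powr_mono2) auto
  finally show ?thesis using t by (simp add: powr_mult)
qed

text \<open>If the oscillation of \<open>f\<close> at scale \<open>\<delta> ^ n\<close> is controlled by \<open>F n\<close>, chaining through points
  with nearly average values of \<open>F\<close> bounds \<open>f\<close> by a power of the scale outside the exceptional
  sets where \<open>F n\<close> is large; the measure of these sets decays fast enough since \<open>\<gamma> < D\<close>.\<close>

lemma locally_integrable_of_oscillation_bounds:
  fixes f :: "'a \<Rightarrow> 'b :: {second_countable_topology, real_normed_vector}" and F :: "nat \<Rightarrow> 'a \<Rightarrow> ennreal"
  assumes p: "0 < p" "p \<le> 1" and \<delta>: "0 < \<delta>" "\<delta> < 1" and D: "upper_dim d M < D"
    and \<gamma>: "0 < \<gamma>" "\<gamma> < D" and G: "0 \<le> G"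
    and f[measurable]: "f \<in> borel_measurable M" and F[measurable]: "\<And>n. F n \<in> borel_measurable M"
    and F_decr: "\<And>n x. F (Suc n) x \<le> F n x"
    and F_int: "\<And>n. (\<integral>\<^sup>+x. F n x \<partial>M) \<le> ennreal (G * (\<delta> powr (D - p * \<gamma>)) ^ n)"
    and N: "N \<in> null_sets M"
    and osc: "\<And>n x y. x \<in> qball d x0 1 - N \<Longrightarrow> y \<in> qball d x0 1 - N \<Longrightarrow> d x y < \<delta> ^ n \<Longrightarrow>
      ennreal (norm (f x - f y) powr p) \<le> F n x + F n y"
  shows "\<exists>r>0. (\<integral>\<^sup>+x\<in>qball d x0 r. ennreal (norm (f x)) \<partial>M) < \<infinity>"
proof -
  have A0: "0 < A0" using A0_ge_1 by simp
  have D0: "0 < D" using \<gamma> by simp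
  \<comment> \<open>Since \<open>A0 * (c + c) = 1\<close>, two points of a ball of radius
    \<open>c * \<delta> ^ n\<close> are closer than \<open>\<delta> ^ n\<close>, as
    \<open>osc\<close> requires. The radius \<open>r0\<close> is so small that for each
    \<open>x\<close> in \<open>B\<close> the ball of radius \<open>c\<close> about \<open>x\<close>
    contains \<open>B\<close> and stays in the unit ball about \<open>x0\<close>.\<close>
  define c where "c = 1 / (2 * A0)"
  define r0 where "r0 = 1 / (4 * A0\<^sup>2)"
  have c: "0 < c" "c \<le> 1 / 2" and r0: "0 < r0" "r0 \<le> 1 / 4" "A0 * (2 * r0) = c" "A0 * (c + c) = 1"
    "A0 * (r0 + c) \<le> 1"
  proof -
    have "1 \<le> A0\<^sup>2" using A0_ge_1 by simp
    then show "r0 \<le> 1 / 4" unfolding r0_def by (intro frac_le) auto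
    show *: "A0 * (2 * r0) = c" "A0 * (c + c) = 1" "0 < c" "0 < r0"
      using A0 by (auto simp: c_def r0_def power2_eq_square field_simps)
    have "A0 * (r0 + c) = c / 2 + 1 / 2" using *(1,2) by (simp add: algebra_simps)
    moreover show "c \<le> 1 / 2" unfolding c_def using A0_ge_1 by (intro frac_le) auto
    ultimately show "A0 * (r0 + c) \<le> 1" by linarith
  qed
  define B where "B = qball d x0 r0"
  have B_sets[measurable]: "B \<in> sets M" unfolding B_def by (rule qball_sets)
  have fin_B: "emeasure M B < \<infinity>" unfolding B_def using r0 qball_finite by simp
  define m0 where "m0 = measure M B"
  have m0: "0 < m0" "emeasure M B = ennreal m0"
    unfolding m0_def B_def using r0 by (auto intro: measure_qball_pos simp: emeasure_qball)
  have sub1: "qball d x c \<subseteq> qball d x0 1" if "x \<in> B" for x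
  proof (rule qball_subset)
    have "A0 * (d x0 x + c) \<le> A0 * (r0 + c)" using that A0 by (simp add: B_def qball_def)
    then show "A0 * (d x0 x + c) \<le> 1" using r0 by simp
  qed
  have sub2: "B \<subseteq> qball d x c" if "x \<in> B" for x
    using qball_dist_less[of x x0 r0 _ r0] that r0 by (auto simp: B_def qball_def)
  \<comment> \<open>Per level, the measure of a ball shrinks at worst by the factor
    \<open>e\<close>, and the bound for \<open>norm (f x) powr p\<close> grows by \<open>q\<close>.
    Their product is the decay rate in \<open>F_int\<close>.\<close>
  define e where "e = \<delta> powr D"
  define q where "q = \<delta> powr (- p * \<gamma>)"
  define \<kappa> where "\<kappa> = m0 / 2 powr D"
  have e: "0 < e" "e < 1" unfolding e_def using \<delta> D0 by (auto simp: powr01_less_one)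
  have "\<delta> powr (p * \<gamma>) < 1" using \<delta> p \<gamma> by (simp add: powr01_less_one)
  then have q: "1 < q" unfolding q_def using \<delta> by (simp add: powr_minus one_less_inverse)
  have \<kappa>: "0 < \<kappa>" using m0 by (simp add: \<kappa>_def)
  have eq: "\<delta> powr (D - p * \<gamma>) = e * q"
    unfolding e_def q_def by (simp flip: powr_add)
  \<comment> \<open>The ball of radius \<open>c\<close> about \<open>x\<close> contains
    \<open>B\<close>, hence has measure at least \<open>m0\<close>; doubling transfers this to the
    smaller balls uniformly in \<open>x\<close>.\<close>
  have low: "\<kappa> * e ^ n \<le> measure M (qball d x (c * \<delta> ^ n))" if "x \<in> B" for x n
  proof -
    have "m0 \<le> measure M (qball d x c)"
      unfolding m0_def using sub2[OF that] c by (intro measure_qball_mono) auto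
    also have "c = (1 / \<delta>) ^ n * (c * \<delta> ^ n)" using \<delta> by (simp add: power_one_over)
    also have "measure M (qball d x \<dots>) \<le> 2 powr D * ((1 / \<delta>) ^ n) powr D * measure M (qball d x (c * \<delta> ^ n))"
      using \<delta> c by (intro measure_qball_scale D) auto
    also have "((1 / \<delta>) ^ n) powr D = 1 / e ^ n"
    proof -
      have "((1 / \<delta>) ^ n) powr D = ((1 / \<delta>) powr D) ^ n"
        using \<delta> by (simp add: powr_powr mult.commute flip: powr_realpow)
      then show ?thesis using \<delta> by (simp add: e_def powr_divide power_one_over)
    qed
    finally show ?thesis using e by (simp add: \<kappa>_def field_simps)
  qed
  have "\<exists>y\<in>B - N. F 0 y \<le> ennreal ((G + 1) / m0)"
  proof (rule exists_le_average)
    have "(\<integral>\<^sup>+x. F 0 x \<partial>M) \<le> ennreal G" using F_int[of 0] by simp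
    also have "\<dots> < ennreal (G + 1)" using G by (simp add: ennreal_less_iff)
    also have "\<dots> = ennreal ((G + 1) / m0) * emeasure M B"
      using m0 G by (simp flip: ennreal_mult)
    finally show "(\<integral>\<^sup>+x. F 0 x \<partial>M) < \<dots>" .
  qed (use N in auto)
  then obtain y0 where y0: "y0 \<in> B" "y0 \<notin> N" "F 0 y0 \<le> ennreal ((G + 1) / m0)" by blast
  define a0 where "a0 = norm (f y0) powr p + (G + 1) / m0"
  \<comment> \<open>Chosen with \<open>t * \<kappa> * (e * q) = G + 1\<close>, which beats
    \<open>G\<close> strictly, even for \<open>G = 0\<close>. This is what the averaging argument
    needs for the threshold \<open>t * q ^ Suc n\<close>.\<close>
  define t where "t = (G + 1) / (\<kappa> * (e * q))"
  have t: "0 \<le> t" "G < t * \<kappa> * (e * q)" using G \<kappa> e q by (auto simp: t_def)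
  \<comment> \<open>The first entry of the maximum starts the induction in \<open>bound\<close>. The
    second gives \<open>L * q ^ n + 2 * t * q ^ Suc n \<le> L * q ^ Suc n\<close>, which closes
    it.\<close>
  define L where "L = max a0 (2 * t * q / (q - 1))"
  have L: "a0 \<le> L" "2 * t * q \<le> L * (q - 1)"
  proof -
    have "2 * t * q / (q - 1) \<le> L" by (simp add: L_def)
    then show "2 * t * q \<le> L * (q - 1)" using q by (simp add: pos_divide_le_eq)
  qed (simp add: L_def)
  have a0: "0 \<le> a0" using G m0 by (simp add: a0_def)
  have L0: "0 \<le> L" using a0 L by simp
  \<comment> \<open>The radius belongs to level \<open>Suc n\<close>, the function to level
    \<open>n\<close>. One point thus serves twice: it lies in the ball of level \<open>n\<close>,
    where the induction hypothesis applies, and \<open>F_decr\<close> bounds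
    \<open>F (Suc n)\<close> there for the comparison with points of level
    \<open>Suc n\<close>.\<close>
  have near: "\<exists>y\<in>qball d x (c * \<delta> ^ Suc n) - N. F n y \<le> ennreal (t * q ^ Suc n)" if "x \<in> B" for x n
  proof (rule exists_le_average)
    have "G * (e * q) ^ n < t * \<kappa> * (e * q) * (e * q) ^ n"
      using t e q by (intro mult_strict_right_mono) auto
    also have "\<dots> = t * q ^ Suc n * (\<kappa> * e ^ Suc n)" by (simp add: power_mult_distrib)
    also have "\<dots> \<le> t * q ^ Suc n * measure M (qball d x (c * \<delta> ^ Suc n))"
      using t q low[OF that, of "Suc n"] by (intro mult_left_mono) auto
    finally have "ennreal (G * (e * q) ^ n) < ennreal (t * q ^ Suc n * measure M (qball d x (c * \<delta> ^ Suc n)))"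
      using G e q by (simp add: ennreal_less_iff)
    also have "\<dots> = ennreal (t * q ^ Suc n) * emeasure M (qball d x (c * \<delta> ^ Suc n))"
      using c \<delta> t q by (subst ennreal_mult) (auto simp: emeasure_qball)
    finally show "(\<integral>\<^sup>+x. F n x \<partial>M) < \<dots>" using F_int[of n] unfolding eq by simp
  qed (use N qball_sets in auto)
  have scale_le: "c * \<delta> ^ Suc n \<le> c * \<delta> ^ n" for n using c \<delta> by (simp add: mult_left_le_one_le)
  have scale_le_c: "c * \<delta> ^ n \<le> c" for n using c \<delta> by (simp add: power_le_one)
  have bound: "\<forall>y\<in>qball d x (c * \<delta> ^ n) - N. ennreal (norm (f y) powr p) \<le> ennreal (L * q ^ n) + F n y"
    if x: "x \<in> B" for x n
  proof (induction n)
    case 0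
    show ?case
    proof
      fix y assume "y \<in> qball d x (c * \<delta> ^ 0) - N"
      then have y: "y \<in> qball d x c" "y \<notin> N" by auto
      have "d y y0 < A0 * (c + c)" using qball_dist_less[OF y(1), of y0 c] sub2[OF x] y0 by blast
      then have "d y y0 < \<delta> ^ 0" using r0 by simp
      then have "ennreal (norm (f y - f y0) powr p) \<le> F 0 y + F 0 y0"
        using sub1[OF x] sub2[OF x] y y0 by (intro osc) auto
      have "ennreal (norm (f y) powr p) \<le> ennreal (norm (f y - f y0) powr p) + ennreal (norm (f y0) powr p)"
        using norm_diff_powr_le[OF p, of "f y" "f y0"] by (simp flip: ennreal_plus)
      also have "\<dots> \<le> (F 0 y + F 0 y0) + ennreal (norm (f y0) powr p)"
        by (intro add_right_mono) fact
      also have "\<dots> \<le> (F 0 y + ennreal ((G + 1) / m0)) + ennreal (norm (f y0) powr p)"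
        by (intro add_right_mono add_left_mono y0)
      also have "\<dots> = F 0 y + ennreal a0" using G m0 by (simp add: a0_def ennreal_plus add_ac)
      also have "\<dots> \<le> F 0 y + ennreal L" using L by (intro add_left_mono ennreal_leI)
      finally show "ennreal (norm (f y) powr p) \<le> ennreal (L * q ^ 0) + F 0 y" by (simp add: add_ac)
    qed
  next
    case (Suc n)
    obtain y' where y': "y' \<in> qball d x (c * \<delta> ^ Suc n)" "y' \<notin> N" "F n y' \<le> ennreal (t * q ^ Suc n)"
      using near[OF x] by blast
    show ?case
    proof
      fix y assume "y \<in> qball d x (c * \<delta> ^ Suc n) - N"
      then have y: "y \<in> qball d x (c * \<delta> ^ Suc n)" "y \<notin> N" by auto
      have "d y y' < A0 * (c * \<delta> ^ Suc n + c * \<delta> ^ Suc n)" by (rule qball_dist_less[OF y(1) y'(1)])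
      also have "\<dots> = A0 * (c + c) * \<delta> ^ Suc n" by (simp add: algebra_simps)
      finally have "d y y' < \<delta> ^ Suc n" using r0 by simp
      then have "ennreal (norm (f y - f y') powr p) \<le> F (Suc n) y + F (Suc n) y'"
        using sub1[OF x] y y' qball_mono[OF scale_le_c, of x "Suc n"] by (intro osc) auto
      also have "\<dots> \<le> F (Suc n) y + ennreal (t * q ^ Suc n)"
        using order_trans[OF F_decr y'(3)] by (intro add_left_mono)
      finally have 1: "ennreal (norm (f y - f y') powr p) \<le> F (Suc n) y + ennreal (t * q ^ Suc n)" .
      have "y' \<in> qball d x (c * \<delta> ^ n) - N" using y' qball_mono[OF scale_le] by blast
      then have "ennreal (norm (f y') powr p) \<le> ennreal (L * q ^ n) + F n y'" using Suc by blast
      also have "\<dots> \<le> ennreal (L * q ^ n) + ennreal (t * q ^ Suc n)" by (intro add_left_mono y')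
      finally have 2: "ennreal (norm (f y') powr p) \<le> ennreal (L * q ^ n) + ennreal (t * q ^ Suc n)" .
      have "ennreal (norm (f y) powr p) \<le> ennreal (norm (f y - f y') powr p) + ennreal (norm (f y') powr p)"
        using norm_diff_powr_le[OF p, of "f y" "f y'"] by (simp flip: ennreal_plus)
      also have "\<dots> \<le> (F (Suc n) y + ennreal (t * q ^ Suc n)) + (ennreal (L * q ^ n) + ennreal (t * q ^ Suc n))"
        by (intro add_mono 1 2)
      also have "\<dots> = F (Suc n) y + ennreal (2 * t * q * q ^ n + L * q ^ n)"
        using t q L0 by (simp add: ennreal_plus[symmetric] add_ac algebra_simps del: ennreal_plus)
      also have "\<dots> \<le> F (Suc n) y + ennreal (L * q ^ Suc n)"
      proof (intro add_left_mono ennreal_leI)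
        have "(2 * t * q) * q ^ n \<le> (L * (q - 1)) * q ^ n" using L q by (intro mult_right_mono) auto
        then show "2 * t * q * q ^ n + L * q ^ n \<le> L * q ^ Suc n" by (simp add: algebra_simps)
      qed
      finally show "ennreal (norm (f y) powr p) \<le> ennreal (L * q ^ Suc n) + F (Suc n) y"
        by (simp add: add_ac)
    qed
  qed
  have bound_x: "ennreal (norm (f x) powr p) \<le> ennreal (L * q ^ n) + F n x" if "x \<in> B - N" for x n
    using bound[of x n] that c \<delta> by (auto intro!: center_in_qball)
  \<comment> \<open>Off \<open>E n\<close> the function \<open>f\<close> is bounded by a pure power
    of the scale. Chebyshev's inequality bounds the measure of \<open>E n\<close> by
    \<open>G * e ^ n\<close>.\<close>
  define E where "E n = {x \<in> B. ennreal (q ^ n) < F n x}" for n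
  have E_sets[measurable]: "E n \<in> sets M" for n
  proof -
    have "E n = B \<inter> {x \<in> space M. ennreal (q ^ n) < F n x}" by (auto simp: E_def space_M)
    then show ?thesis by simp
  qed
  have E_meas: "emeasure M (E n) \<le> ennreal (G * e ^ n)" for n
  proof -
    have "emeasure M (E n) \<le> emeasure M B" by (intro emeasure_mono) (auto simp: E_def)
    then have fin: "emeasure M (E n) < \<infinity>" using fin_B by (simp add: le_less_trans)
    have "ennreal (q ^ n) * emeasure M (E n) = (\<integral>\<^sup>+x. ennreal (q ^ n) * indicator (E n) x \<partial>M)"
      by (simp add: nn_integral_cmult_indicator)
    also have "\<dots> \<le> (\<integral>\<^sup>+x. F n x \<partial>M)"
      by (intro nn_integral_mono) (auto simp: E_def indicator_def)
    also have "\<dots> \<le> ennreal (G * (e * q) ^ n)" using F_int[of n] by (simp add: eq)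
    finally have "ennreal (q ^ n * measure M (E n)) \<le> ennreal (G * (e * q) ^ n)"
      using fin q by (simp add: emeasure_eq_ennreal_measure ennreal_mult)
    then have "q ^ n * measure M (E n) \<le> q ^ n * (G * e ^ n)"
      using G e q by (simp add: power_mult_distrib mult_ac)
    then have "measure M (E n) \<le> G * e ^ n" using q by simp
    then show ?thesis using fin by (simp add: emeasure_eq_ennreal_measure ennreal_leI)
  qed
  have null: "(\<Inter>n. E n) \<in> null_sets M"
  proof -
    have "emeasure M (\<Inter>n. E n) \<le> ennreal (G * e ^ n)" for n
      by (rule order_trans[OF emeasure_mono E_meas]) auto
    moreover have "(\<lambda>n. ennreal (G * e ^ n)) \<longlonglongrightarrow> ennreal (G * 0)"
      using e by (intro tendsto_intros LIMSEQ_realpow_zero) auto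
    ultimately have "emeasure M (\<Inter>n. E n) \<le> ennreal (G * 0)"
      by (intro LIMSEQ_le_const) auto
    then show ?thesis by (intro null_setsI) auto
  qed
  define K where "K = (L + 1) powr (1 / p)"
  define h where "h = \<delta> powr (- \<gamma>)"
  have h: "0 < h" using \<delta> by (simp add: h_def)
  have K: "0 \<le> K" by (simp add: K_def)
  have small: "norm (f x) \<le> K * h ^ n" if x: "x \<in> B - N" "x \<notin> E n" for x n
  proof -
    have "F n x \<le> ennreal (q ^ n)" using x by (auto simp: E_def)
    then have "ennreal (norm (f x) powr p) \<le> ennreal (L * q ^ n) + ennreal (q ^ n)"
      using bound_x[OF x(1), of n] by (meson add_left_mono order_trans)
    also have "\<dots> = ennreal ((L + 1) * q ^ n)" using L0 q by (simp add: algebra_simps flip: ennreal_plus)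
    finally have "norm (f x) powr p \<le> (L + 1) * q ^ n" using L0 q by simp
    then have "(norm (f x) powr p) powr (1 / p) \<le> ((L + 1) * q ^ n) powr (1 / p)"
      using p by (intro powr_mono2) auto
    also have "\<dots> = K * (q ^ n) powr (1 / p)" using L0 q by (simp add: powr_mult K_def)
    also have "(q ^ n) powr (1 / p) = h ^ n"
      unfolding q_def h_def using p \<delta> by (simp add: powr_powr field_simps flip: powr_realpow)
    finally show ?thesis using p by (simp add: powr_powr)
  qed
  \<comment> \<open>Let \<open>n\<close> be the first index with \<open>x \<notin> E n\<close>. If
    it is 0, the constant term suffices. If it is \<open>Suc m\<close>, then
    \<open>x \<in> E m\<close>, and summand \<open>m\<close> carries the bound
    \<open>K * h ^ Suc m\<close>; hence the shift of the exponent.\<close>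
  have pointwise: "ennreal (norm (f x)) * indicator B x \<le> ennreal K * indicator B x + (\<Sum>n. ennreal (K * h ^ Suc n) * indicator (E n) x)"
    (is "_ \<le> _ + suminf ?g") if x: "x \<notin> N" "x \<notin> (\<Inter>n. E n)" for x
  proof (cases "x \<in> B")
    case True
    define n where "n = (LEAST n. x \<notin> E n)"
    obtain k where "x \<notin> E k" using x by blast
    then have n: "x \<notin> E n" unfolding n_def by (rule LeastI)
    have fn: "norm (f x) \<le> K * h ^ n" using small n x True by blast
    show ?thesis
    proof (cases n)
      case 0
      then have "ennreal (norm (f x)) * indicator B x \<le> ennreal K * indicator B x"
        using fn True by (simp add: ennreal_leI)
      then show ?thesis by (simp add: add_increasing2)
    next
      case (Suc m)
      then have "x \<in> E m" using not_less_Least[of m "\<lambda>n. x \<notin> E n"] by (simp add: n_def)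
      then have "ennreal (norm (f x)) * indicator B x \<le> ?g m"
        using fn Suc True by (simp add: ennreal_leI)
      also have "\<dots> \<le> suminf ?g" by (rule ennreal_le_suminf)
      finally show ?thesis by (simp add: add_increasing)
    qed
  qed simp
  have "AE x in M. ennreal (norm (f x)) * indicator B x \<le>
      ennreal K * indicator B x + (\<Sum>n. ennreal (K * h ^ Suc n) * indicator (E n) x)"
    using AE_not_in[OF N] AE_not_in[OF null] by eventually_elim (rule pointwise)
  then have "(\<integral>\<^sup>+x. ennreal (norm (f x)) * indicator B x \<partial>M) \<le>
      (\<integral>\<^sup>+x. ennreal K * indicator B x + (\<Sum>n. ennreal (K * h ^ Suc n) * indicator (E n) x) \<partial>M)"
    by (rule nn_integral_mono_AE)
  also have "\<dots> = ennreal K * emeasure M B + (\<Sum>n. ennreal (K * h ^ Suc n) * emeasure M (E n))"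
    by (simp add: nn_integral_add nn_integral_suminf nn_integral_cmult_indicator)
  also have "\<dots> \<le> ennreal K * emeasure M B + (\<Sum>n. ennreal (K * h * G * (h * e) ^ n))"
  proof (intro add_left_mono suminf_le)
    fix n
    have "ennreal (K * h ^ Suc n) * emeasure M (E n) \<le> ennreal (K * h ^ Suc n) * ennreal (G * e ^ n)"
      by (intro mult_left_mono E_meas) auto
    also have "\<dots> = ennreal (K * h * G * (h * e) ^ n)"
      using K h G e by (simp add: power_mult_distrib mult_ac flip: ennreal_mult)
    finally show "ennreal (K * h ^ Suc n) * emeasure M (E n) \<le> ennreal (K * h * G * (h * e) ^ n)" .
  qed auto
  also have "\<dots> < \<infinity>"
  proof -
    \<comment> \<open>Here \<open>\<gamma> < D\<close> makes the series geometric with ratio below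
      1.\<close>
    have "h * e = \<delta> powr (D - \<gamma>)" by (simp add: h_def e_def flip: powr_add)
    also have "\<dots> < 1" using \<delta> \<gamma> by (simp add: powr01_less_one)
    finally have "summable (\<lambda>n. K * h * G * (h * e) ^ n)"
      using h e by (intro summable_mult summable_geometric) auto
    then have "(\<Sum>n. ennreal (K * h * G * (h * e) ^ n)) < \<infinity>"
      using K h G e by (subst suminf_ennreal2) auto
    then show ?thesis using fin_B by (simp add: ennreal_mult_less_top)
  qed
  finally show ?thesis using r0 by (auto simp: B_def)
qed

end

section \<open>Consequences of the matrix weight condition\<close>

definition weighted_norm :: "('a \<Rightarrow> complex^'m^'m) \<Rightarrow> real \<Rightarrow> 'a \<Rightarrow> complex^'m \<Rightarrow> real" where
  "weighted_norm W p x v = norm (mat_powr (W x) (1 / p) *v v)"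

lemma weighted_norm_nonneg [simp]: "0 \<le> weighted_norm W p x v"
  by (simp add: weighted_norm_def)

lemma borel_measurable_vec_nth:
  fixes g :: "'a \<Rightarrow> complex^'m"
  assumes "g \<in> borel_measurable M"
  shows "(\<lambda>x. g x $ i) \<in> borel_measurable M"
  using measurable_compose[OF assms, of "\<lambda>v. v $ i" borel]
    borel_measurable_continuous_onI[of "\<lambda>v :: complex^'m. v $ i"]
  by (simp add: continuous_intros)

lemma borel_measurable_vecI:
  fixes g :: "'a \<Rightarrow> complex^'m"
  assumes "\<And>i. (\<lambda>x. g x $ i) \<in> borel_measurable M"
  shows "g \<in> borel_measurable M"
proof (subst borel_measurable_euclidean_space, intro ballI)
  fix b :: "complex^'m" assume "b \<in> Basis"
  then obtain i c where "b = axis i c" by (auto simp: Basis_vec_def)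
  then show "(\<lambda>x. g x \<bullet> b) \<in> borel_measurable M"
    using assms[of i] by (simp add: inner_axis)
qed

lemma matrix_weightD:
  assumes "matrix_weight d M W"
  shows "nonneg_definite (W x)" "AE x in M. invertible (W x)" "(\<lambda>x. W x $ i $ j) \<in> borel_measurable M"
  using assms by (auto simp: matrix_weight_def L1_loc_def)

lemma weighted_norm_measurable:
  fixes W :: "'a \<Rightarrow> complex^'m^'m"
  assumes W: "matrix_weight d M W" and p: "0 < p" and g: "g \<in> borel_measurable M"
  shows "(\<lambda>x. weighted_norm W p x (g x)) \<in> borel_measurable M"
proof -
  have [measurable]: "(\<lambda>x. mat_powr (W x) (1 / p) $ i $ j) \<in> borel_measurable M" for i j
    using p by (intro mat_powr_measurable matrix_weightD[OF W]) auto
  note [measurable] = borel_measurable_vec_nth[OF g]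
  have "(\<lambda>x. mat_powr (W x) (1 / p) *v g x) \<in> borel_measurable M"
    by (intro borel_measurable_vecI) (simp add: matrix_vector_mult_def)
  then show ?thesis by (simp add: weighted_norm_def)
qed

text \<open>Inserting the identity as \<open>W y\<close> to the powers \<open>- 1 / p\<close> and
  \<open>1 / p\<close> makes the kernel of the \<open>A_p\<close> characteristic a comparison of
  weighted norms at two points.\<close>

lemma weighted_norm_le_op_norm:
  assumes "nonneg_definite (W y)" "invertible (W y)"
  shows "weighted_norm W p x v \<le>
    op_norm (mat_powr (W x) (1 / p) ** mat_powr (W y) (- 1 / p)) * weighted_norm W p y v"
proof -
  have "mat_powr (W y) (- 1 / p) ** mat_powr (W y) (1 / p) = mat 1"
    using mat_powr_minus_inverse[OF assms, of "1 / p"] by simp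
  then have "mat_powr (W x) (1 / p) *v v =
      (mat_powr (W x) (1 / p) ** mat_powr (W y) (- 1 / p)) *v (mat_powr (W y) (1 / p) *v v)"
    by (metis matrix_mul_assoc matrix_mul_rid matrix_vector_mul_assoc)
  then show ?thesis unfolding weighted_norm_def by (metis norm_le_op_norm)
qed

lemma norm_le_weighted_norm:
  assumes "nonneg_definite (W y)" "invertible (W y)"
  shows "norm v \<le> op_norm (mat_powr (W y) (- 1 / p)) * weighted_norm W p y v"
proof -
  have "mat_powr (W y) (- 1 / p) ** mat_powr (W y) (1 / p) = mat 1"
    using mat_powr_minus_inverse[OF assms, of "1 / p"] by simp
  then have "v = mat_powr (W y) (- 1 / p) *v (mat_powr (W y) (1 / p) *v v)"
    by (simp add: matrix_vector_mul_assoc)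
  then show ?thesis unfolding weighted_norm_def by (metis norm_le_op_norm)
qed

lemma ennpowr_le:
  assumes "x \<le> ennreal a" "0 \<le> a" "0 < r"
  shows "ennpowr x r \<le> ennreal (a powr r)"
proof -
  have "x \<noteq> \<infinity>" using assms(1) by (auto simp: top_unique)
  moreover have "enn2real x \<le> a" using assms by (simp add: enn2real_leI)
  ultimately show ?thesis using assms by (auto simp: ennpowr_def intro!: ennreal_leI powr_mono2)
qed

lemma le_ennpowr:
  assumes "ennreal a \<le> x" "0 \<le> a" "0 < r"
  shows "ennreal (a powr r) \<le> ennpowr x r"
proof (cases "x = \<infinity>")
  case False
  then have "a \<le> enn2real x" using assms by (cases x) auto
  then show ?thesis using assms False by (auto simp: ennpowr_def intro!: ennreal_leI powr_mono2)
qed (simp add: ennpowr_def)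

lemma nn_integral_le_of_avg_le:
  assumes "avg M B h \<le> K" "0 < emeasure M B" "emeasure M B < \<infinity>"
  shows "(\<integral>\<^sup>+x\<in>B. h x \<partial>M) \<le> K * emeasure M B"
proof -
  have "(\<integral>\<^sup>+x\<in>B. h x \<partial>M) = avg M B h * emeasure M B"
    using assms unfolding avg_def ennreal_divide_times by simp
  then show ?thesis using assms by (simp add: mult_right_mono)
qed

section \<open>Pointwise and dual forms of the \<open>A_p\<close> condition\<close>

context homogeneous_space
begin

text \<open>The comparison of weighted norms at \<open>x\<close> and \<open>y\<close> is integrated
  in \<open>x\<close> for fixed \<open>y\<close>. As the kernel does not involve \<open>v\<close>,
  the exceptional set of \<open>y\<close> depends only on the ball, not on the vector.\<close>

lemma Ap_weight_nn_integral_le: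
  fixes W :: "'a \<Rightarrow> complex^'m^'m"
  assumes W: "W \<in> Ap_weights d M p" and p: "0 < p" "p \<le> 1"
  obtains K where "0 < K" "\<And>x0 r. 0 < r \<Longrightarrow> AE y in M. y \<in> qball d x0 r \<longrightarrow> (\<forall>v.
    (\<integral>\<^sup>+x\<in>qball d x0 r. ennreal (weighted_norm W p x v powr p) \<partial>M) \<le>
    ennreal (K * measure M (qball d x0 r) * weighted_norm W p y v powr p))"
proof -
  define T where "T x y = op_norm (mat_powr (W x) (1 / p) ** mat_powr (W y) (- 1 / p))" for x y
  have mw: "matrix_weight d M W" and fin: "Ap_char d M p W < \<infinity>"
    using W by (auto simp: Ap_weights_def)
  define K where "K = enn2real (Ap_char d M p W) + 1"
  have K: "0 < K" "Ap_char d M p W \<le> ennreal K"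
    using fin by (auto simp: K_def add_nonneg_pos intro: order_trans[OF _ ennreal_leI[of "enn2real (Ap_char d M p W)"]])
  have "AE y in M. y \<in> qball d x0 r \<longrightarrow> (\<forall>v.
    (\<integral>\<^sup>+x\<in>qball d x0 r. ennreal (weighted_norm W p x v powr p) \<partial>M) \<le>
    ennreal (K * measure M (qball d x0 r) * weighted_norm W p y v powr p))" if r: "0 < r" for x0 r
  proof -
    define B where "B = qball d x0 r"
    have B[measurable]: "B \<in> sets M" and B_meas: "0 < emeasure M B" "emeasure M B < \<infinity>"
      and B_eq: "emeasure M B = ennreal (measure M B)"
      unfolding B_def using r qball_sets qball_pos qball_finite emeasure_qball by blast+
    have "esssup (restrict_space M B) (\<lambda>y. avg M B (\<lambda>x. ennreal (T x y powr p))) \<le> Ap_char d M p W"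
      unfolding Ap_char_def Let_def T_def B_def using p r
      by (auto intro!: SUP_upper2[of "(x0, r)"])
    then have "AE y in restrict_space M B. avg M B (\<lambda>x. ennreal (T x y powr p)) \<le> ennreal K"
      using esssup_AE[of "\<lambda>y. avg M B (\<lambda>x. ennreal (T x y powr p))" "restrict_space M B"] K
      by (auto elim!: eventually_mono)
    then have "AE y in M. y \<in> B \<longrightarrow> avg M B (\<lambda>x. ennreal (T x y powr p)) \<le> ennreal K"
      by (subst (asm) AE_restrict_space_iff) (auto simp: space_M)
    with matrix_weightD(2)[OF mw] show ?thesis
      unfolding B_def[symmetric]
    proof eventually_elim
      fix y assume inv: "invertible (W y)" and av: "y \<in> B \<longrightarrow> avg M B (\<lambda>x. ennreal (T x y powr p)) \<le> ennreal K"
      show "y \<in> B \<longrightarrow> (\<forall>v. (\<integral>\<^sup>+x\<in>B. ennreal (weighted_norm W p x v powr p) \<partial>M)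
        \<le> ennreal (K * measure M B * weighted_norm W p y v powr p))"
      proof (intro impI allI)
        fix v assume "y \<in> B"
        define c where "c = weighted_norm W p y v"
        have c0: "0 \<le> c" by (simp add: c_def)
        have le: "weighted_norm W p x v \<le> T x y * c" for x
          unfolding T_def c_def by (intro weighted_norm_le_op_norm matrix_weightD[OF mw] inv)
        have T: "(\<integral>\<^sup>+x\<in>B. ennreal (T x y powr p) \<partial>M) \<le> ennreal K * emeasure M B"
          using av \<open>y \<in> B\<close> B_meas by (intro nn_integral_le_of_avg_le) auto
        have [measurable]: "(\<lambda>x. weighted_norm W p x v) \<in> borel_measurable M"
          by (rule weighted_norm_measurable[OF mw p(1)]) simp
        show "(\<integral>\<^sup>+x\<in>B. ennreal (weighted_norm W p x v powr p) \<partial>M) \<le> ennreal (K * measure M B * weighted_norm W p y v powr p)"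
        \<comment> \<open>Dividing by \<open>c\<close> allows the factor to be pulled out of the
          integral of a measurable function. The kernel \<open>T\<close> enters only through
          monotonicity, so its measurability in \<open>x\<close> is never invoked.\<close>
        proof (cases "c = 0")
          case True
          then have "weighted_norm W p x v = 0" for x
            using le[of x] by (simp add: antisym)
          then show ?thesis by simp
        next
          case False
          then have c: "0 < c" using c0 by simp
          have "(\<integral>\<^sup>+x\<in>B. ennreal (weighted_norm W p x v powr p) \<partial>M) =
              (\<integral>\<^sup>+x. ennreal (c powr p) * (ennreal ((weighted_norm W p x v / c) powr p) * indicator B x) \<partial>M)"
            using c by (intro nn_integral_cong) (auto simp: indicator_def powr_divide simp flip: ennreal_mult)
          also have "\<dots> = ennreal (c powr p) * (\<integral>\<^sup>+x\<in>B. ennreal ((weighted_norm W p x v / c) powr p) \<partial>M)"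
            by (rule nn_integral_cmult) simp
          also have "\<dots> \<le> ennreal (c powr p) * (\<integral>\<^sup>+x\<in>B. ennreal (T x y powr p) \<partial>M)"
            using le c p by (intro mult_left_mono nn_integral_mono mult_right_mono ennreal_leI powr_mono2)
              (auto simp: pos_divide_le_eq)
          also have "\<dots> \<le> ennreal (c powr p) * (ennreal K * emeasure M B)"
            by (intro mult_left_mono T) auto
          also have "\<dots> = ennreal (K * measure M B * weighted_norm W p y v powr p)"
            using K unfolding B_eq c_def[symmetric] by (simp add: ennreal_mult mult_ac)
          finally show ?thesis .
        qed
      qed
    qed
  qed
  with K(1) show thesis by (rule that)
qed

text \<open>The outer average is finite, so the inner one is finite at some \<open>x1\<close> with
  \<open>W x1\<close> invertible. Then \<open>\<kappa> y\<close> is the kernel at \<open>x1\<close>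
  and \<open>y\<close>, and \<open>c\<close> is the operator norm of \<open>W x1\<close> to the
  power \<open>- 1 / p\<close>: a vector is estimated by its weighted norm at \<open>x1\<close>, and
  this by the one at \<open>y\<close>.\<close>

lemma Ap_weight_dual_integrable:
  fixes W :: "'a \<Rightarrow> complex^'m^'m"
  assumes W: "W \<in> Ap_weights d M p" and p: "1 < p" and r: "0 < r"
  obtains c \<kappa> where "0 \<le> c" "\<And>y. 0 \<le> \<kappa> y"
    "(\<integral>\<^sup>+y\<in>qball d x0 r. ennreal (\<kappa> y powr (p / (p - 1))) \<partial>M) < \<infinity>"
    "AE y in M. \<forall>v. norm v \<le> c * (\<kappa> y * weighted_norm W p y v)"
proof -
  define T where "T x y = op_norm (mat_powr (W x) (1 / p) ** mat_powr (W y) (- 1 / p))" for x y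
  have mw: "matrix_weight d M W" and fin: "Ap_char d M p W < \<infinity>"
    using W by (auto simp: Ap_weights_def)
  define p' where "p' = p / (p - 1)"
  define B where "B = qball d x0 r"
  have B[measurable]: "B \<in> sets M" and B_meas: "0 < emeasure M B" "emeasure M B < \<infinity>"
    unfolding B_def using r qball_sets qball_pos qball_finite by blast+
  define \<phi> where "\<phi> x = avg M B (\<lambda>y. ennreal (T x y powr p'))" for x
  have "avg M B (\<lambda>x. ennpowr (\<phi> x) (p / p')) \<le> Ap_char d M p W"
    unfolding Ap_char_def Let_def T_def B_def \<phi>_def p'_def using p r
    by (auto intro!: SUP_upper2[of "(x0, r)"])
  then have "avg M B (\<lambda>x. ennpowr (\<phi> x) (p / p')) < \<infinity>" using fin by (rule le_less_trans)
  then have int: "(\<integral>\<^sup>+x\<in>B. ennpowr (\<phi> x) (p / p') \<partial>M) < \<infinity>"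
    using nn_integral_le_of_avg_le[OF order_refl B_meas] B_meas by (metis ennreal_mult_less_top infinity_ennreal_def le_less_trans)
  have "\<exists>x1\<in>B. invertible (W x1) \<and> \<phi> x1 < \<infinity>"
  proof (rule ccontr)
    assume neg: "\<not> ?thesis"
    have "AE x in M. \<infinity> * indicator B x \<le> ennpowr (\<phi> x) (p / p') * indicator B x"
      using matrix_weightD(2)[OF mw]
    proof eventually_elim
      fix x assume "invertible (W x)"
      then have "x \<in> B \<Longrightarrow> \<phi> x = \<infinity>" using neg by (metis infinity_ennreal_def less_top)
      then show "\<infinity> * indicator B x \<le> ennpowr (\<phi> x) (p / p') * indicator B x"
        by (auto simp: indicator_def ennpowr_def)
    qed
    then have "(\<integral>\<^sup>+x. \<infinity> * indicator B x \<partial>M) \<le> (\<integral>\<^sup>+x\<in>B. ennpowr (\<phi> x) (p / p') \<partial>M)"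
      by (rule nn_integral_mono_AE)
    moreover have "(\<integral>\<^sup>+x. \<infinity> * indicator B x \<partial>M) = \<infinity> * emeasure M B"
      by (rule nn_integral_cmult_indicator) simp
    ultimately show False using int B_meas by (auto simp: ennreal_top_mult top_unique split: if_splits)
  qed
  then obtain x1 where x1: "x1 \<in> B" "invertible (W x1)" "\<phi> x1 < \<infinity>" by blast
  define c where "c = op_norm (mat_powr (W x1) (- 1 / p))"
  show thesis
  proof
    show "0 \<le> c" by (simp add: c_def op_norm_nonneg)
    show "0 \<le> T x1 y" for y by (simp add: T_def op_norm_nonneg)
    show "(\<integral>\<^sup>+y\<in>qball d x0 r. ennreal (T x1 y powr (p / (p - 1))) \<partial>M) < \<infinity>"
      unfolding B_def[symmetric] p'_def[symmetric]
      by (rule le_less_trans[OF nn_integral_le_of_avg_le[OF order_refl B_meas]])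
        (use x1(3) B_meas in \<open>simp add: \<phi>_def ennreal_mult_less_top\<close>)
    show "AE y in M. \<forall>v. norm v \<le> c * (T x1 y * weighted_norm W p y v)"
      using matrix_weightD(2)[OF mw]
    proof eventually_elim
      fix y assume inv: "invertible (W y)"
      show "\<forall>v. norm v \<le> c * (T x1 y * weighted_norm W p y v)"
      proof
        fix v
        have "norm v \<le> c * weighted_norm W p x1 v"
          unfolding c_def by (intro norm_le_weighted_norm matrix_weightD[OF mw] x1)
        also have "\<dots> \<le> c * (T x1 y * weighted_norm W p y v)"
          unfolding T_def by (intro mult_left_mono weighted_norm_le_op_norm matrix_weightD[OF mw] inv)
            (simp add: c_def op_norm_nonneg)
        finally show "norm v \<le> c * (T x1 y * weighted_norm W p y v)" .
      qed
    qed
  qed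
qed

text \<open>Young's inequality does the work of Hoelder's: on the ball, \<open>norm (g x)\<close> is
  at most a constant times the sum of the p-th power of the weighted norm and the conjugate power of
  \<open>\<kappa>\<close>. Division by \<open>c + 1\<close> avoids the case
  \<open>c = 0\<close>.\<close>

lemma weighted_Lp_imp_L1:
  fixes W :: "'a \<Rightarrow> complex^'m^'m"
  assumes W: "W \<in> Ap_weights d M p" and p: "1 < p" and r: "0 < r"
    and g: "g \<in> borel_measurable M"
    and int: "(\<integral>\<^sup>+x. ennreal (weighted_norm W p x (g x) powr p) \<partial>M) < \<infinity>"
  shows "(\<integral>\<^sup>+x\<in>qball d x0 r. ennreal (norm (g x)) \<partial>M) < \<infinity>"
proof -
  obtain c \<kappa> where c: "0 \<le> c" and \<kappa>: "\<And>y. 0 \<le> \<kappa> y"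
    and \<kappa>_int: "(\<integral>\<^sup>+y\<in>qball d x0 r. ennreal (\<kappa> y powr (p / (p - 1))) \<partial>M) < \<infinity>"
    and AE_le: "AE y in M. \<forall>v. norm v \<le> c * (\<kappa> y * weighted_norm W p y v)"
    by (rule Ap_weight_dual_integrable[OF W p r, of x0]) (rule that)
  define B where "B = qball d x0 r"
  have B[measurable]: "B \<in> sets M" by (simp add: B_def qball_sets)
  note [measurable] = g
  have mw: "matrix_weight d M W" using W by (simp add: Ap_weights_def)
  define a where "a x = ennreal (weighted_norm W p x (g x) powr p) * indicator B x" for x
  define u where "u x = ennreal (norm (g x) / (c + 1)) * indicator B x" for x
  have [measurable]: "(\<lambda>x. weighted_norm W p x (g x)) \<in> borel_measurable M"
    using p by (intro weighted_norm_measurable[OF mw] g) auto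
  have [measurable]: "a \<in> borel_measurable M" "u \<in> borel_measurable M"
    unfolding a_def[abs_def] u_def[abs_def] by simp_all
  \<comment> \<open>\<open>\<kappa>\<close> need not be measurable, so its integral can only be used to bound that of the measurable
    function \<open>u - a\<close>, not additively in a bound of \<open>u\<close>.\<close>
  have "AE x in M. u x - a x \<le> ennreal (\<kappa> x powr (p / (p - 1))) * indicator B x"
    using AE_le
  proof eventually_elim
    fix x assume le: "\<forall>v. norm v \<le> c * (\<kappa> x * weighted_norm W p x v)"
    let ?w = "weighted_norm W p x (g x)"
    have "norm (g x) \<le> c * (\<kappa> x * ?w)" using le by blast
    also have "\<dots> \<le> (c + 1) * (\<kappa> x * ?w)" using \<kappa>[of x] by (intro mult_right_mono) auto
    finally have "norm (g x) / (c + 1) \<le> \<kappa> x * ?w" using c by (simp add: pos_divide_le_eq mult.commute)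
    also have "\<kappa> x * ?w \<le> ?w powr p / p + \<kappa> x powr (p / (p - 1)) / (p / (p - 1))"
      using p \<kappa>[of x] Youngs_inequality[of p "p / (p - 1)" ?w "\<kappa> x"]
      by (simp add: field_simps)
    also have "\<dots> \<le> ?w powr p + \<kappa> x powr (p / (p - 1))"
    proof (intro add_mono)
      have div_le: "t / q \<le> t" if "0 \<le> t" "1 \<le> q" for t q :: real
        using frac_le[of t t 1 q] that by simp
      show "?w powr p / p \<le> ?w powr p" using p by (intro div_le) auto
      show "\<kappa> x powr (p / (p - 1)) / (p / (p - 1)) \<le> \<kappa> x powr (p / (p - 1))"
        using p by (intro div_le) (auto simp: field_simps)
    qed
    finally have "ennreal (norm (g x) / (c + 1)) \<le> ennreal (?w powr p) + ennreal (\<kappa> x powr (p / (p - 1)))"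
      by (simp flip: ennreal_plus)
    then show "u x - a x \<le> ennreal (\<kappa> x powr (p / (p - 1))) * indicator B x"
      by (auto simp: u_def a_def indicator_def ennreal_minus_le_iff)
  qed
  then have 1: "(\<integral>\<^sup>+x. u x - a x \<partial>M) < \<infinity>"
    using \<kappa>_int unfolding B_def by (rule le_less_trans[OF nn_integral_mono_AE])
  have "(\<integral>\<^sup>+x. a x \<partial>M) \<le> (\<integral>\<^sup>+x. ennreal (weighted_norm W p x (g x) powr p) \<partial>M)"
    by (intro nn_integral_mono) (auto simp: a_def indicator_def)
  then have 2: "(\<integral>\<^sup>+x. a x \<partial>M) < \<infinity>" using int by (rule le_less_trans)
  have "(\<integral>\<^sup>+x. u x \<partial>M) \<le> (\<integral>\<^sup>+x. a x + (u x - a x) \<partial>M)"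
    by (intro nn_integral_mono) (use linear in \<open>auto simp: add_diff_self_ennreal\<close>)
  also have "\<dots> = (\<integral>\<^sup>+x. a x \<partial>M) + (\<integral>\<^sup>+x. u x - a x \<partial>M)"
    by (intro nn_integral_add) auto
  also have "\<dots> < \<infinity>" using 1 2 by simp
  finally have "ennreal (c + 1) * (\<integral>\<^sup>+x. u x \<partial>M) < \<infinity>" by (simp add: ennreal_mult_less_top)
  also have "ennreal (c + 1) * (\<integral>\<^sup>+x. u x \<partial>M) = (\<integral>\<^sup>+x. ennreal (c + 1) * u x \<partial>M)"
    by (intro nn_integral_cmult[symmetric]) auto
  also have "\<dots> = (\<integral>\<^sup>+x\<in>qball d x0 r. ennreal (norm (g x)) \<partial>M)"
    using c by (intro nn_integral_cong) (auto simp: u_def B_def indicator_def simp del: ennreal_plus simp flip: ennreal_mult)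
  finally show ?thesis .
qed

end

section \<open>Hajlasz gradients\<close>

lemma le_of_ennpowr_le:
  assumes "ennpowr x r \<le> ennreal S" "0 < r" "0 \<le> S"
  shows "x \<le> ennreal (S powr (1 / r))"
proof (cases x)
  case (real a)
  then have "a powr r \<le> S" using assms by (simp add: ennpowr_def)
  then have "(a powr r) powr (1 / r) \<le> S powr (1 / r)"
    using assms by (intro powr_mono2) auto
  then show ?thesis using real assms by (simp add: powr_powr ennreal_leI)
next
  case top
  then show ?thesis using assms by (simp add: ennpowr_def top_unique)
qed

text \<open>Each level is bounded by the whole sum or supremum. From here on, \<open>q\<close>
  enters only through this uniform bound.\<close>

lemma weighted_lq_Lp_norm_bounded:
  assumes fin: "weighted_lq_Lp_norm M p q W g < \<infinity>" and p: "0 < p" and q: "0 < q"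
  obtains G where "0 \<le> G"
    "\<And>k. (\<integral>\<^sup>+x. ennreal (weighted_norm W p x (g k x) powr p) \<partial>M) \<le> ennreal G"
proof -
  define n where "n k = (\<integral>\<^sup>+x. ennreal (weighted_norm W p x (g k x) powr p) \<partial>M)" for k
  have norm_eq: "weighted_lq_Lp_norm M p q W g =
    (if q = \<infinity> then (SUP k. ennpowr (n k) (1 / p))
     else ennpowr (\<Sum>\<^sub>\<infinity>k. ennpowr (n k) (enn2real q / p)) (1 / enn2real q))"
    unfolding weighted_lq_Lp_norm_def Let_def n_def weighted_norm_def by (rule refl)
  have "\<exists>r S. 0 < r \<and> S < \<infinity> \<and> (\<forall>k. ennpowr (n k) r \<le> S)"
  proof (cases "q = \<infinity>")
    case True
    have "ennpowr (n k) (1 / p) \<le> weighted_lq_Lp_norm M p q W g" for k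
      unfolding norm_eq if_P[OF True] by (rule SUP_upper[OF UNIV_I])
    then show ?thesis using fin p
      by (intro exI[of _ "1 / p"] exI[of _ "weighted_lq_Lp_norm M p q W g"]) simp
  next
    case False
    define S where "S = (\<Sum>\<^sub>\<infinity>k. ennpowr (n k) (enn2real q / p))"
    have "ennpowr S (1 / enn2real q) < \<infinity>"
      using fin False unfolding norm_eq S_def[symmetric] by simp
    then have "S \<noteq> \<infinity>" by (auto simp: ennpowr_def)
    moreover have "ennpowr (n k) (enn2real q / p) \<le> S" for k
    proof -
      have "ennpowr (n k) (enn2real q / p) = (\<Sum>\<^sub>\<infinity>k\<in>{k}. ennpowr (n k) (enn2real q / p))" by simp
      also have "\<dots> \<le> S" unfolding S_def
        by (rule infsum_mono_neutral) (auto intro: nonneg_summable_on_complete)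
      finally show ?thesis .
    qed
    moreover have "0 < enn2real q" using q False by (simp add: enn2real_positive_iff less_top)
    ultimately show ?thesis using p
      by (intro exI[of _ "enn2real q / p"] exI[of _ S]) (auto simp: less_top)
  qed
  then obtain r S where rS: "0 < r" "S < \<infinity>" "\<And>k. ennpowr (n k) r \<le> S" by blast
  then have "ennpowr (n k) r \<le> ennreal (enn2real S)" for k by simp
  then have "n k \<le> ennreal (enn2real S powr (1 / r))" for k
    using rS by (intro le_of_ennpowr_le) auto
  then show thesis by (intro that[of "enn2real S powr (1 / r)"]) (auto simp: n_def)
qed

text \<open>The least exponent \<open>k\<close> with \<open>\<delta> ^ k \<le> t\<close> is not 0
  since \<open>t < 1\<close>; its predecessor is the scale sought.\<close>

lemma exists_geometric_scale:
  fixes \<delta> t :: real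
  assumes "0 < \<delta>" "\<delta> < 1" "0 < t" "t < 1"
  shows "\<exists>n::nat. t \<in> {\<delta> powi (int n + 1)..<\<delta> powi int n}"
proof -
  have "\<exists>k. \<delta> ^ k \<le> t" using real_arch_pow_inv[of t \<delta>] assms by (auto intro: less_imp_le)
  then have le: "\<delta> ^ (LEAST k. \<delta> ^ k \<le> t) \<le> t" by (rule LeastI_ex)
  then have "(LEAST k. \<delta> ^ k \<le> t) \<noteq> 0" using assms by (metis not_le power_0)
  then obtain n where n: "(LEAST k. \<delta> ^ k \<le> t) = Suc n" using not0_implies_Suc by blast
  then have "t < \<delta> ^ n" using not_less_Least[of n "\<lambda>k. \<delta> ^ k \<le> t"] by simp
  moreover have "\<delta> powi (int n + 1) = \<delta> ^ Suc n"
    using power_int_of_nat[of \<delta> "Suc n"] by (simp add: add.commute)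
  ultimately show ?thesis using le n by (intro exI[of _ n]) simp
qed

text \<open>Below 1 only the factor with \<open>fst b\<close> survives. It grows at most like a
  power of \<open>log \<delta> t\<close>, which the loss from \<open>s\<close> to \<open>s'\<close>
  absorbs.\<close>

lemma log_weight_le_powr:
  assumes \<delta>: "0 < \<delta>" "\<delta> < 1" and s: "s' < s"
  shows "\<exists>C>0. \<forall>t. 0 < t \<longrightarrow> t < 1 \<longrightarrow> log_weight \<delta> s b t \<le> C * t powr s'"
proof -
  define \<beta> where "\<beta> = \<bar>fst b\<bar>"
  \<comment> \<open>For \<open>\<tau> = log \<delta> t\<close> this rate makes
    \<open>exp (\<eta> * \<tau> * \<beta>)\<close> at most \<open>t powr (s' - s)\<close>; the
    \<open>+ 1\<close> covers \<open>\<beta> = 0\<close>. The constant \<open>m\<close> below is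
    such that \<open>1 + \<tau> \<le> m * exp (\<eta> * \<tau>)\<close>.\<close>
  define \<eta> where "\<eta> = (s - s') * (- ln \<delta>) / (\<beta> + 1)"
  have ln: "ln \<delta> < 0" using \<delta> by simp
  have \<beta>: "0 \<le> \<beta>" by (simp add: \<beta>_def)
  have \<eta>: "0 < \<eta>" unfolding \<eta>_def using s ln \<beta> by (intro divide_pos_pos mult_pos_pos) auto
  define m where "m = max 1 (1 / \<eta>)"
  have m: "1 \<le> m" "1 \<le> m * \<eta>"
  proof -
    have "1 / \<eta> * \<eta> \<le> m * \<eta>" unfolding m_def using \<eta> by (intro mult_right_mono) auto
    then show "1 \<le> m * \<eta>" using \<eta> by simp
  qed (simp add: m_def)
  have "log_weight \<delta> s b t \<le> m powr \<beta> * t powr s'" if t: "0 < t" "t < 1" for t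
  proof -
    define \<tau> where "\<tau> = log \<delta> t"
    have \<tau>: "0 \<le> \<tau>" "ln t = \<tau> * ln \<delta>"
      using t \<delta> ln by (auto simp: \<tau>_def log_def divide_nonpos_neg zero_le_divide_iff)
    have "1 + \<tau> \<le> m + m * \<eta> * \<tau>"
      using m \<tau> mult_right_mono[of 1 "m * \<eta>" \<tau>] by simp
    also have "\<dots> = m * (1 + \<eta> * \<tau>)" by (simp add: algebra_simps)
    also have "\<dots> \<le> m * exp (\<eta> * \<tau>)" using m by (intro mult_left_mono exp_ge_add_one_self) auto
    finally have le: "1 + \<tau> \<le> m * exp (\<eta> * \<tau>)" .
    have "(1 + \<tau>) powr (- fst b) \<le> (1 + \<tau>) powr \<beta>"
      using \<tau> by (intro powr_mono) (auto simp: \<beta>_def)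
    also have "\<dots> \<le> (m * exp (\<eta> * \<tau>)) powr \<beta>" using le \<tau> \<beta> by (intro powr_mono2) auto
    also have "\<dots> = m powr \<beta> * exp (\<eta> * \<tau> * \<beta>)"
      using m by (simp add: powr_mult exp_powr_real)
    also have "\<dots> \<le> m powr \<beta> * exp ((s - s') * (- ln \<delta>) * \<tau>)"
    proof (intro mult_left_mono)
      have "\<eta> * \<beta> \<le> \<eta> * (\<beta> + 1)" using \<eta> by simp
      also have "\<dots> = (s - s') * (- ln \<delta>)" unfolding \<eta>_def using \<beta> by simp
      finally have "\<eta> * \<beta> * \<tau> \<le> (s - s') * (- ln \<delta>) * \<tau>" using \<tau> by (intro mult_right_mono) auto
      then have "\<eta> * \<tau> * \<beta> \<le> (s - s') * (- ln \<delta>) * \<tau>" by (simp only: mult_ac)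
      then show "exp (\<eta> * \<tau> * \<beta>) \<le> exp ((s - s') * (- ln \<delta>) * \<tau>)" by (simp only: exp_le_cancel_iff)
    qed simp
    also have "exp ((s - s') * (- ln \<delta>) * \<tau>) = t powr (s' - s)"
      using t by (simp add: powr_def \<tau>(2) algebra_simps)
    finally have "t powr s * (1 + \<tau>) powr (- fst b) \<le> t powr s * (m powr \<beta> * t powr (s' - s))"
      by (intro mult_left_mono) auto
    also have "\<dots> = m powr \<beta> * t powr s'" using t by (simp add: powr_diff)
    finally show ?thesis using t by (simp add: log_weight_def \<tau>_def)
  qed
  then show ?thesis using m by (intro exI[of _ "m powr \<beta>"]) auto
qed

section \<open>Dyadic cubes and the gradient inequality on one cube\<close>

context dyadic_system
begin

lemma delta_less_1: "\<delta> < 1"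
proof -
  have "\<delta> < inverse (2 * A0)" using delta_less by simp
  also have "\<dots> \<le> 1" using A0_ge_1 by (simp add: field_simps)
  finally show ?thesis .
qed

lemma infsum_cubes:
  fixes h :: "'i \<Rightarrow> real"
  assumes "\<alpha> \<in> I k" "x \<in> Q k \<alpha>"
  shows "(\<Sum>\<^sub>\<infinity>\<beta>\<in>I k. h \<beta> * indicator (Q k \<beta>) x) = h \<alpha>"
proof -
  have "x \<notin> Q k \<beta>" if "\<beta> \<in> I k" "\<beta> \<noteq> \<alpha>" for \<beta>
    using cubes_disjoint[of k] that assms by (auto simp: disjoint_family_on_def)
  then have "(\<Sum>\<^sub>\<infinity>\<beta>\<in>I k. h \<beta> * indicator (Q k \<beta>) x) = (\<Sum>\<^sub>\<infinity>\<beta>\<in>{\<alpha>}. h \<beta> * indicator (Q k \<beta>) x)"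
    using assms by (intro infsum_cong_neutral) (auto simp: indicator_def)
  then show ?thesis using assms by simp
qed

lemma hajlasz_gradient_cube:
  assumes "g \<in> hajlasz_gradients M d \<delta> I Q A s b f"
  obtains N where "\<And>k. N k \<in> null_sets M"
    "\<And>k \<alpha> x y. \<alpha> \<in> I k \<Longrightarrow> x \<in> Q k \<alpha> \<Longrightarrow> x \<notin> N k \<Longrightarrow> y \<notin> N k \<Longrightarrow>
      d x y \<in> {\<delta> powi (k + 1)..<\<delta> powi k} \<Longrightarrow>
      norm (A k \<alpha> *v f x - A k \<alpha> *v f y) \<le>
      log_weight \<delta> s b (d x y) * (norm (A k \<alpha> *v g k x) + norm (A k \<alpha> *v g k y))"
proof -
  have "\<forall>k. \<exists>N. N \<in> null_sets M \<and> (\<forall>x y. x \<notin> N \<longrightarrow> y \<notin> N \<longrightarrow> d x y \<in> {\<delta> powi (k + 1)..<\<delta> powi k} \<longrightarrow>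
        (\<Sum>\<^sub>\<infinity>\<alpha>\<in>I k. norm (A k \<alpha> *v f x - A k \<alpha> *v f y) * indicator (Q k \<alpha>) x)
        \<le> log_weight \<delta> s b (d x y) *
          (\<Sum>\<^sub>\<infinity>\<alpha>\<in>I k. (norm (A k \<alpha> *v g k x) + norm (A k \<alpha> *v g k y)) * indicator (Q k \<alpha>) x))"
    using assms unfolding hajlasz_gradients_def Bex_def mem_Collect_eq by (intro allI) (drule spec, erule conjunct2)
  from choice[OF this] obtain N where N: "\<And>k. N k \<in> null_sets M" and
    le: "\<And>k x y. x \<notin> N k \<Longrightarrow> y \<notin> N k \<Longrightarrow> d x y \<in> {\<delta> powi (k + 1)..<\<delta> powi k} \<Longrightarrow>
        (\<Sum>\<^sub>\<infinity>\<alpha>\<in>I k. norm (A k \<alpha> *v f x - A k \<alpha> *v f y) * indicator (Q k \<alpha>) x)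
        \<le> log_weight \<delta> s b (d x y) *
          (\<Sum>\<^sub>\<infinity>\<alpha>\<in>I k. (norm (A k \<alpha> *v g k x) + norm (A k \<alpha> *v g k y)) * indicator (Q k \<alpha>) x)"
    by blast
  show thesis
  proof (rule that[OF N])
    fix k \<alpha> x y
    assume "\<alpha> \<in> I k" "x \<in> Q k \<alpha>" "x \<notin> N k" "y \<notin> N k" "d x y \<in> {\<delta> powi (k + 1)..<\<delta> powi k}"
    then show "norm (A k \<alpha> *v f x - A k \<alpha> *v f y) \<le>
      log_weight \<delta> s b (d x y) * (norm (A k \<alpha> *v g k x) + norm (A k \<alpha> *v g k y))"
      using le[of x k y] by (simp add: infsum_cubes)
  qed
qed

lemma cube_measure:
  assumes "\<alpha> \<in> I k"
  shows "0 < emeasure M (Q k \<alpha>)" "emeasure M (Q k \<alpha>) < \<infinity>"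
    "measure M (qball d (z k \<alpha>) (inverse (3 * A0\<^sup>2) * c0 * \<delta> powi k)) \<le> measure M (Q k \<alpha>)"
proof -
  have pos: "0 < inverse (3 * A0\<^sup>2) * c0 * \<delta> powi k" "0 < 2 * A0 * C0 * \<delta> powi k"
    using A0_ge_1 c0_pos c0_le_C0 delta_pos by (auto intro!: mult_pos_pos zero_less_power_int)
  have "0 < emeasure M (qball d (z k \<alpha>) (inverse (3 * A0\<^sup>2) * c0 * \<delta> powi k))"
    using pos qball_pos by blast
  also have "\<dots> \<le> emeasure M (Q k \<alpha>)"
    by (rule emeasure_mono[OF cube_inner[OF assms] cubes_sets[OF assms]])
  finally show "0 < emeasure M (Q k \<alpha>)" .
  have "emeasure M (Q k \<alpha>) \<le> emeasure M (qball d (z k \<alpha>) (2 * A0 * C0 * \<delta> powi k))"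
    by (rule emeasure_mono[OF cube_outer[OF assms] qball_sets])
  also have "\<dots> < \<infinity>" using pos qball_finite by blast
  finally show fin: "emeasure M (Q k \<alpha>) < \<infinity>" .
  show "measure M (qball d (z k \<alpha>) (inverse (3 * A0\<^sup>2) * c0 * \<delta> powi k)) \<le> measure M (Q k \<alpha>)"
    using fin cube_inner[OF assms] cubes_sets[OF assms] qball_sets
    by (intro measure_mono_fmeasurable) (auto simp: fmeasurable_def)
qed

text \<open>Disjoint sets of positive measure in a ball of finite measure have summable measures.
  Countability lets the null sets attached to single cubes be merged into one.\<close>

lemma countable_cubes_in_ball:
  assumes "0 < R"
  shows "countable {\<alpha>\<in>I k. Q k \<alpha> \<subseteq> qball d x R}" (is "countable ?J")
proof -
  have "(\<lambda>\<alpha>. measure M (Q k \<alpha>)) summable_on ?J"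
  proof (rule nonneg_bdd_above_summable_on)
    show "bdd_above (sum (\<lambda>\<alpha>. measure M (Q k \<alpha>)) ` {F. F \<subseteq> ?J \<and> finite F})"
    proof (rule bdd_aboveI2)
      fix F assume F: "F \<in> {F. F \<subseteq> ?J \<and> finite F}"
      have "(\<Sum>\<alpha>\<in>F. measure M (Q k \<alpha>)) = measure M (\<Union>\<alpha>\<in>F. Q k \<alpha>)"
        using F cubes_sets cube_measure(2) disjoint_family_on_mono[OF _ cubes_disjoint, of F k]
        by (intro measure_finite_Union[symmetric]) (auto simp: subset_iff less_top)
      also have "\<dots> \<le> measure M (qball d x R)"
        using F cubes_sets assms by (intro measure_qball_mono sets.finite_UN) auto
      finally show "(\<Sum>\<alpha>\<in>F. measure M (Q k \<alpha>)) \<le> measure M (qball d x R)" .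
    qed
  qed simp
  then have "countable {\<alpha>\<in>?J. measure M (Q k \<alpha>) \<noteq> 0}" by (rule summable_countable_real)
  moreover have "measure M (Q k \<alpha>) \<noteq> 0" if "\<alpha> \<in> I k" for \<alpha>
    using cube_measure(1,2)[OF that] by (auto simp: measure_def enn2real_eq_0_iff)
  ultimately show ?thesis by (auto elim!: back_subst[of countable])
qed

end

section \<open>Reducing operators for small exponents\<close>

context dyadic_system
begin

lemma reducing_operators_bounds:
  assumes "reducing_operators M I Q p W A"
  shows "\<exists>c>0. \<forall>k. \<forall>\<alpha>\<in>I k. \<forall>v.
      ennreal c * ennpowr (avg M (Q k \<alpha>) (\<lambda>x. ennreal (weighted_norm W p x v powr p))) (1 / p)
        \<le> ennreal (norm (A k \<alpha> *v v))"
    and "\<exists>C>0. \<forall>k. \<forall>\<alpha>\<in>I k. \<forall>v. ennreal (norm (A k \<alpha> *v v)) \<le>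
      ennreal C * ennpowr (avg M (Q k \<alpha>) (\<lambda>x. ennreal (weighted_norm W p x v powr p))) (1 / p)"
  using assms unfolding reducing_operators_def Let_def weighted_norm_def by blast+

lemma delta_powi_pos: "0 < \<delta> powi k"
  using delta_pos by (simp add: zero_less_power_int)

text \<open>The \<open>A_p\<close> estimate is applied on a ball that contains both the cube and the
  target ball. By doubling its measure is comparable to that of the cube, with a factor independent
  of the level; the null set depends on the cube but not on \<open>v\<close>.\<close>

lemma reducing_le_weighted_norm:
  fixes W :: "'a \<Rightarrow> complex^'m^'m"
  assumes W: "W \<in> Ap_weights d M p" and p: "0 < p" "p \<le> 1" and red: "reducing_operators M I Q p W A"
  obtains K where "0 < K" "\<And>k \<alpha>. \<alpha> \<in> I k \<Longrightarrow> AE y in M. y \<in> qball d (z k \<alpha>) (R * \<delta> powi k) \<longrightarrow>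
    (\<forall>v. norm (A k \<alpha> *v v) \<le> K * weighted_norm W p y v)"
proof -
  obtain C where C: "0 < C" and
    le_avg: "\<And>k \<alpha> v. \<alpha> \<in> I k \<Longrightarrow> ennreal (norm (A k \<alpha> *v v)) \<le>
      ennreal C * ennpowr (avg M (Q k \<alpha>) (\<lambda>x. ennreal (weighted_norm W p x v powr p))) (1 / p)"
    using reducing_operators_bounds(2)[OF red] by blast
  obtain K1 where K1: "0 < K1" and
    Ap: "\<And>x0 r. 0 < r \<Longrightarrow> AE y in M. y \<in> qball d x0 r \<longrightarrow> (\<forall>v.
    (\<integral>\<^sup>+x\<in>qball d x0 r. ennreal (weighted_norm W p x v powr p) \<partial>M) \<le>
    ennreal (K1 * measure M (qball d x0 r) * weighted_norm W p y v powr p))"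
    by (rule Ap_weight_nn_integral_le[OF W p]) (rule that)
  define D where "D = upper_dim d M + 1"
  define r1 where "r1 = inverse (3 * A0\<^sup>2) * c0"
  \<comment> \<open>The entries ensure that the ball contains the target ball, that it contains the
    cube, and that its ratio to the inner ball of the cube is at least 1, as the doubling estimate
    demands.\<close>
  define R' where "R' = max R (max (2 * A0 * C0) r1)"
  have r1: "0 < r1" using A0_ge_1 c0_pos by (simp add: r1_def)
  have R': "R \<le> R'" "2 * A0 * C0 \<le> R'" "r1 \<le> R'" "0 < R'" using r1 by (auto simp: R'_def)
  define K2 where "K2 = 2 powr D * (R' / r1) powr D"
  have K2: "0 < K2" using R' r1 by (simp add: K2_def)
  define K where "K = C * (K1 * K2) powr (1 / p)"
  have "AE y in M. y \<in> qball d (z k \<alpha>) (R * \<delta> powi k) \<longrightarrow>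
    (\<forall>v. norm (A k \<alpha> *v v) \<le> K * weighted_norm W p y v)" if \<alpha>: "\<alpha> \<in> I k" for k \<alpha>
  proof -
    define B where "B = qball d (z k \<alpha>) (R' * \<delta> powi k)"
    have sub: "qball d (z k \<alpha>) (R * \<delta> powi k) \<subseteq> B"
      unfolding B_def using R' delta_powi_pos[of k] by (intro qball_mono mult_right_mono) auto
    have QB: "Q k \<alpha> \<subseteq> B"
      unfolding B_def using R' delta_powi_pos[of k]
      by (intro order_trans[OF cube_outer[OF \<alpha>]] qball_mono mult_right_mono) auto
    have pos: "0 < R' * \<delta> powi k" using R' delta_powi_pos by simp
    have Qm: "0 < measure M (Q k \<alpha>)" "emeasure M (Q k \<alpha>) = ennreal (measure M (Q k \<alpha>))"
      using cube_measure(1,2)[OF \<alpha>] by (simp_all add: emeasure_eq_ennreal_measure)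
    have B_le: "measure M B \<le> K2 * measure M (Q k \<alpha>)"
    proof -
      have "R' * \<delta> powi k = R' / r1 * (r1 * \<delta> powi k)" using r1 by simp
      then have "measure M B \<le> K2 * measure M (qball d (z k \<alpha>) (r1 * \<delta> powi k))"
        unfolding B_def K2_def using R' r1 delta_powi_pos[of k]
        by (metis measure_qball_scale D_def le_divide_eq_1_pos less_add_one mult_pos_pos)
      also have "\<dots> \<le> K2 * measure M (Q k \<alpha>)"
        using cube_measure(3)[OF \<alpha>] K2 by (intro mult_left_mono) (auto simp: r1_def)
      finally show ?thesis .
    qed
    show ?thesis
      using Ap[OF pos, of "z k \<alpha>"] unfolding B_def[symmetric]
    proof eventually_elim
      fix y assume int: "y \<in> B \<longrightarrow> (\<forall>v. (\<integral>\<^sup>+x\<in>B. ennreal (weighted_norm W p x v powr p) \<partial>M)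
        \<le> ennreal (K1 * measure M B * weighted_norm W p y v powr p))"
      show "y \<in> qball d (z k \<alpha>) (R * \<delta> powi k) \<longrightarrow> (\<forall>v. norm (A k \<alpha> *v v) \<le> K * weighted_norm W p y v)"
      proof (intro impI allI)
        fix v assume "y \<in> qball d (z k \<alpha>) (R * \<delta> powi k)"
        then have "y \<in> B" using sub by blast
        let ?w = "weighted_norm W p y v"
        have "(\<integral>\<^sup>+x\<in>Q k \<alpha>. ennreal (weighted_norm W p x v powr p) \<partial>M) \<le> (\<integral>\<^sup>+x\<in>B. ennreal (weighted_norm W p x v powr p) \<partial>M)"
          using QB by (intro nn_integral_mono) (auto simp: indicator_def)
        also have "\<dots> \<le> ennreal (K1 * measure M B * ?w powr p)" using int \<open>y \<in> B\<close> by blast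
        also have "\<dots> \<le> ennreal (K1 * (K2 * measure M (Q k \<alpha>)) * ?w powr p)"
          using B_le K1 by (intro ennreal_leI mult_right_mono mult_left_mono) auto
        finally have "avg M (Q k \<alpha>) (\<lambda>x. ennreal (weighted_norm W p x v powr p)) \<le>
            ennreal (K1 * (K2 * measure M (Q k \<alpha>)) * ?w powr p) / ennreal (measure M (Q k \<alpha>))"
          unfolding avg_def Qm(2) by (rule divide_right_mono_ennreal)
        also have "\<dots> = ennreal (K1 * K2 * ?w powr p)"
          using Qm(1) K1 K2 by (simp add: divide_ennreal)
        finally have "ennpowr (avg M (Q k \<alpha>) (\<lambda>x. ennreal (weighted_norm W p x v powr p))) (1 / p) \<le>
            ennreal ((K1 * K2 * ?w powr p) powr (1 / p))"
          using K1 K2 p by (intro ennpowr_le) auto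
        also have "(K1 * K2 * ?w powr p) powr (1 / p) = (K1 * K2) powr (1 / p) * ?w"
          using K1 K2 p by (simp add: powr_mult powr_powr)
        finally have "ennreal C * ennpowr (avg M (Q k \<alpha>) (\<lambda>x. ennreal (weighted_norm W p x v powr p))) (1 / p) \<le>
            ennreal C * ennreal ((K1 * K2) powr (1 / p) * ?w)"
          by (intro mult_left_mono) auto
        also have "\<dots> = ennreal (K * ?w)" using C by (simp add: K_def mult_ac flip: ennreal_mult)
        finally have "ennreal (norm (A k \<alpha> *v v)) \<le> ennreal (K * ?w)"
          using le_avg[OF \<alpha>] order_trans by blast
        then show "norm (A k \<alpha> *v v) \<le> K * ?w" using C by (simp add: K_def)
      qed
    qed
  qed
  moreover have "0 < K" using C K1 K2 by (simp add: K_def)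
  ultimately show thesis using that by blast
qed

text \<open>One cube of level 0 suffices: its reducing operator is a single positive definite
  matrix, hence bounded below, and the radius about its center is taken large enough to cover the
  given ball.\<close>

lemma norm_le_weighted_norm_on_qball:
  fixes W :: "'a \<Rightarrow> complex^'m^'m"
  assumes W: "W \<in> Ap_weights d M p" and p: "0 < p" "p \<le> 1" and red: "reducing_operators M I Q p W A"
  obtains K where "0 < K" "AE y in M. y \<in> qball d x0 R \<longrightarrow> (\<forall>v. norm v \<le> K * weighted_norm W p y v)"
proof -
  obtain \<alpha> where \<alpha>: "\<alpha> \<in> I 0" using cubes_cover[of 0] by blast
  define R' where "R' = A0 * (d (z 0 \<alpha>) x0 + R)"
  obtain K where K: "0 < K" and le: "\<And>k \<alpha>. \<alpha> \<in> I k \<Longrightarrow>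
      AE y in M. y \<in> qball d (z k \<alpha>) (R' * \<delta> powi k) \<longrightarrow>
    (\<forall>v. norm (A k \<alpha> *v v) \<le> K * weighted_norm W p y v)"
    by (rule reducing_le_weighted_norm[OF W p red, where R = R']) (rule that)
  have "pos_definite (A 0 \<alpha>)" using red \<alpha> by (simp add: reducing_operators_def)
  then obtain c where c: "0 < c" "\<And>v. c * norm v \<le> norm (A 0 \<alpha> *v v)"
    by (rule pos_definite_bounded_below) (rule that)
  have "AE y in M. y \<in> qball d x0 R \<longrightarrow> (\<forall>v. norm v \<le> K / c * weighted_norm W p y v)"
    using le[OF \<alpha>]
  proof eventually_elim
    fix y assume y: "y \<in> qball d (z 0 \<alpha>) (R' * \<delta> powi 0) \<longrightarrow>
      (\<forall>v. norm (A 0 \<alpha> *v v) \<le> K * weighted_norm W p y v)"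
    show "y \<in> qball d x0 R \<longrightarrow> (\<forall>v. norm v \<le> K / c * weighted_norm W p y v)"
    proof (intro impI allI)
      fix v assume "y \<in> qball d x0 R"
      then have "y \<in> qball d (z 0 \<alpha>) (R' * \<delta> powi 0)"
        using qball_subset[of "z 0 \<alpha>" x0 R R'] by (auto simp: R'_def)
      then have "c * norm v \<le> K * weighted_norm W p y v" using y c(2)[of v] order_trans by blast
      then show "norm v \<le> K / c * weighted_norm W p y v" using c by (simp add: field_simps)
    qed
  qed
  then show thesis using K c by (intro that[of "K / c"]) auto
qed

text \<open>The pointwise lower bound for the weighted norm on the large ball is averaged over the
  cube. The constant is independent of the level, as chaining through all fine scales
  requires.\<close>

lemma reducing_bounded_below:
  fixes W :: "'a \<Rightarrow> complex^'m^'m"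
  assumes W: "W \<in> Ap_weights d M p" and p: "0 < p" "p \<le> 1" and red: "reducing_operators M I Q p W A"
  obtains K where "0 < K"
    "\<And>k \<alpha> v. \<alpha> \<in> I k \<Longrightarrow> Q k \<alpha> \<subseteq> qball d x0 R \<Longrightarrow> norm v \<le> K * norm (A k \<alpha> *v v)"
proof -
  obtain K where K: "0 < K" and
    le: "AE y in M. y \<in> qball d x0 R \<longrightarrow> (\<forall>v. norm v \<le> K * weighted_norm W p y v)"
    by (rule norm_le_weighted_norm_on_qball[OF W p red]) (rule that)
  obtain c where c: "0 < c" and avg_le: "\<And>k \<alpha> v. \<alpha> \<in> I k \<Longrightarrow>
      ennreal c * ennpowr (avg M (Q k \<alpha>) (\<lambda>x. ennreal (weighted_norm W p x v powr p))) (1 / p)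
        \<le> ennreal (norm (A k \<alpha> *v v))"
    using reducing_operators_bounds(1)[OF red] by blast
  have "norm v \<le> K / c * norm (A k \<alpha> *v v)" if \<alpha>: "\<alpha> \<in> I k" and sub: "Q k \<alpha> \<subseteq> qball d x0 R" for k \<alpha> v
  proof -
    let ?a = "(norm v / K) powr p"
    have Qm: "0 < measure M (Q k \<alpha>)" "emeasure M (Q k \<alpha>) = ennreal (measure M (Q k \<alpha>))"
      using cube_measure(1,2)[OF \<alpha>] by (simp_all add: emeasure_eq_ennreal_measure)
    have "ennreal ?a * emeasure M (Q k \<alpha>) = (\<integral>\<^sup>+x\<in>Q k \<alpha>. ennreal ?a \<partial>M)"
      using cubes_sets[OF \<alpha>] by (simp add: nn_integral_cmult_indicator)
    also have "\<dots> \<le> (\<integral>\<^sup>+x\<in>Q k \<alpha>. ennreal (weighted_norm W p x v powr p) \<partial>M)"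
    proof (rule nn_integral_mono_AE)
      show "AE x in M. ennreal ?a * indicator (Q k \<alpha>) x \<le> ennreal (weighted_norm W p x v powr p) * indicator (Q k \<alpha>) x"
        using le
      proof eventually_elim
        fix x assume "x \<in> qball d x0 R \<longrightarrow> (\<forall>v. norm v \<le> K * weighted_norm W p x v)"
        then have "x \<in> Q k \<alpha> \<Longrightarrow> norm v / K \<le> weighted_norm W p x v"
          using sub K by (auto simp: pos_divide_le_eq mult.commute)
        then show "ennreal ?a * indicator (Q k \<alpha>) x \<le> ennreal (weighted_norm W p x v powr p) * indicator (Q k \<alpha>) x"
          using K p by (auto simp: indicator_def intro!: ennreal_leI powr_mono2)
      qed
    qed
    finally have "ennreal ?a * emeasure M (Q k \<alpha>) / emeasure M (Q k \<alpha>) \<le>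
        avg M (Q k \<alpha>) (\<lambda>x. ennreal (weighted_norm W p x v powr p))"
      unfolding avg_def by (rule divide_right_mono_ennreal)
    also have "ennreal ?a * emeasure M (Q k \<alpha>) / emeasure M (Q k \<alpha>) = ennreal ?a"
      using Qm by (intro mult_divide_eq_ennreal) auto
    finally have "ennreal (?a powr (1 / p)) \<le> ennpowr (avg M (Q k \<alpha>) (\<lambda>x. ennreal (weighted_norm W p x v powr p))) (1 / p)"
      using p by (intro le_ennpowr) auto
    then have "ennreal c * ennreal (?a powr (1 / p)) \<le> ennreal (norm (A k \<alpha> *v v))"
      using avg_le[OF \<alpha>, of v] by (meson mult_left_mono order_trans zero_le)
    moreover have "?a powr (1 / p) = norm v / K" using p K by (simp add: powr_powr)
    ultimately have "c * (norm v / K) \<le> norm (A k \<alpha> *v v)"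
      using c K by (simp flip: ennreal_mult)
    then show ?thesis using c K by (simp add: field_simps)
  qed
  then show thesis using K c by (intro that[of "K / c"]) auto
qed

text \<open>The reducing operators are stripped from the gradient inequality, by the lower bound on
  the left and the upper bound on the right. At nonnegative levels all relevant cubes lie in one
  fixed ball, so the constants are uniform and countably many null sets combine into
  \<open>N\<close>.\<close>

lemma local_oscillation:
  fixes W :: "'a \<Rightarrow> complex^'m^'m"
  assumes W: "W \<in> Ap_weights d M p" and p: "0 < p" "p \<le> 1" and red: "reducing_operators M I Q p W A"
    and g: "g \<in> hajlasz_gradients M d \<delta> I Q A s b f"
  obtains N C where "N \<in> null_sets M" "0 < C"
    "\<And>n x y. x \<in> qball d x0 1 - N \<Longrightarrow> y \<in> qball d x0 1 - N \<Longrightarrow>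
      d x y \<in> {\<delta> powi (int n + 1)..<\<delta> powi int n} \<Longrightarrow>
      norm (f x - f y) \<le> C * log_weight \<delta> s b (d x y) *
        (weighted_norm W p x (g (int n) x) + weighted_norm W p y (g (int n) y))"
proof -
  \<comment> \<open>\<open>R0\<close> bounds the distance of two points of a cube of nonnegative
    level, so a cube meeting the unit ball about \<open>x0\<close> lies in the ball of radius
    \<open>R\<close>. With \<open>c2\<close>, both a point of the cube and any point within
    \<open>\<delta> powi int n\<close> of it are near the center.\<close>
  define R0 where "R0 = A0 * (2 * A0 * C0 + 2 * A0 * C0)"
  define R where "R = A0 * (1 + R0)"
  define c2 where "c2 = A0 * (2 * A0 * C0 + 1)"
  have AC: "0 < A0" "0 < C0" using A0_ge_1 c0_pos c0_le_C0 by auto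
  then have R: "0 < R" by (simp add: R_def R0_def add_pos_nonneg)
  obtain N where N: "\<And>k. N k \<in> null_sets M" and grad:
    "\<And>k \<alpha> x y. \<alpha> \<in> I k \<Longrightarrow> x \<in> Q k \<alpha> \<Longrightarrow> x \<notin> N k \<Longrightarrow> y \<notin> N k \<Longrightarrow>
      d x y \<in> {\<delta> powi (k + 1)..<\<delta> powi k} \<Longrightarrow>
      norm (A k \<alpha> *v f x - A k \<alpha> *v f y) \<le>
      log_weight \<delta> s b (d x y) * (norm (A k \<alpha> *v g k x) + norm (A k \<alpha> *v g k y))"
    by (rule hajlasz_gradient_cube[OF g]) (rule that)
  obtain K1 where K1: "0 < K1" and
    le1: "\<And>k \<alpha> v. \<alpha> \<in> I k \<Longrightarrow> Q k \<alpha> \<subseteq> qball d x0 R \<Longrightarrow> norm v \<le> K1 * norm (A k \<alpha> *v v)"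
    by (rule reducing_bounded_below[OF W p red]) (rule that)
  obtain K2 where K2: "0 < K2" and
    le2: "\<And>k \<alpha>. \<alpha> \<in> I k \<Longrightarrow> AE y in M. y \<in> qball d (z k \<alpha>) (c2 * \<delta> powi k) \<longrightarrow>
    (\<forall>v. norm (A k \<alpha> *v v) \<le> K2 * weighted_norm W p y v)"
    by (rule reducing_le_weighted_norm[OF W p red]) (rule that)
  have "AE y in M. \<forall>\<alpha>\<in>{\<alpha>\<in>I (int n). Q (int n) \<alpha> \<subseteq> qball d x0 R}. y \<in> qball d (z (int n) \<alpha>) (c2 * \<delta> powi int n) \<longrightarrow>
    (\<forall>v. norm (A (int n) \<alpha> *v v) \<le> K2 * weighted_norm W p y v)" for n
    unfolding AE_ball_countable[OF countable_cubes_in_ball[OF R]] using le2 by blast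
  moreover have "AE y in M. y \<notin> N (int n)" for n using N AE_not_in by blast
  ultimately have "AE y in M. \<forall>n. y \<notin> N (int n) \<and> (\<forall>\<alpha>\<in>{\<alpha>\<in>I (int n). Q (int n) \<alpha> \<subseteq> qball d x0 R}.
      y \<in> qball d (z (int n) \<alpha>) (c2 * \<delta> powi int n) \<longrightarrow>
      (\<forall>v. norm (A (int n) \<alpha> *v v) \<le> K2 * weighted_norm W p y v))"
    unfolding AE_all_countable by simp
  then obtain N' where N': "N' \<in> null_sets M" and
    good: "\<And>y n. y \<notin> N' \<Longrightarrow> y \<notin> N (int n)"
      "\<And>y n \<alpha> v. y \<notin> N' \<Longrightarrow> \<alpha> \<in> I (int n) \<Longrightarrow> Q (int n) \<alpha> \<subseteq> qball d x0 R \<Longrightarrow>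
        y \<in> qball d (z (int n) \<alpha>) (c2 * \<delta> powi int n) \<Longrightarrow> norm (A (int n) \<alpha> *v v) \<le> K2 * weighted_norm W p y v"
    unfolding eventually_ae_filter by (fastforce simp: space_M)
  have "norm (f x - f y) \<le> K1 * K2 * log_weight \<delta> s b (d x y) *
      (weighted_norm W p x (g (int n) x) + weighted_norm W p y (g (int n) y))"
    if x: "x \<in> qball d x0 1 - N'" and y: "y \<in> qball d x0 1 - N'"
      and dist: "d x y \<in> {\<delta> powi (int n + 1)..<\<delta> powi int n}" for n x y
  proof -
    obtain \<alpha> where \<alpha>: "\<alpha> \<in> I (int n)" "x \<in> Q (int n) \<alpha>" using cubes_cover[of "int n"] by blast
    have dn: "0 < \<delta> powi int n" "\<delta> powi int n \<le> 1"
      using delta_pos delta_less_1 by (auto simp: power_le_one)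
    have Qz: "Q (int n) \<alpha> \<subseteq> qball d (z (int n) \<alpha>) (2 * A0 * C0)"
      using AC dn by (intro order_trans[OF cube_outer[OF \<alpha>(1)]] qball_mono mult_left_le) auto
    have Qx: "Q (int n) \<alpha> \<subseteq> qball d x R0"
      using qball_dist_less[of x "z (int n) \<alpha>" "2 * A0 * C0" _ "2 * A0 * C0"] Qz \<alpha>(2)
      unfolding R0_def qball_def by blast
    have QR: "Q (int n) \<alpha> \<subseteq> qball d x0 R"
    proof (rule order_trans[OF Qx qball_subset])
      show "A0 * (d x0 x + R0) \<le> R" unfolding R_def using x AC by (auto simp: qball_def)
    qed
    have xz: "x \<in> qball d (z (int n) \<alpha>) (2 * A0 * C0 * \<delta> powi int n)"
      using cube_outer[OF \<alpha>(1)] \<alpha>(2) by blast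
    have xB: "x \<in> qball d (z (int n) \<alpha>) (c2 * \<delta> powi int n)"
    proof -
      have "2 * A0 * C0 \<le> A0 * (2 * A0 * C0)" using A0_ge_1 AC mult_right_mono[of 1 A0 "2 * A0 * C0"] by simp
      then have "2 * A0 * C0 \<le> c2" using AC unfolding c2_def distrib_left by linarith
      then show ?thesis using xz dn qball_mono[of "2 * A0 * C0 * \<delta> powi int n" "c2 * \<delta> powi int n"]
        by (auto simp: subset_iff mult_right_mono)
    qed
    have yB: "y \<in> qball d (z (int n) \<alpha>) (c2 * \<delta> powi int n)"
    proof -
      have "A0 * (d (z (int n) \<alpha>) x + \<delta> powi int n) \<le> A0 * (2 * A0 * C0 * \<delta> powi int n + \<delta> powi int n)"
        using xz AC by (intro mult_left_mono) (auto simp: qball_def)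
      also have "\<dots> = c2 * \<delta> powi int n" by (simp add: c2_def algebra_simps)
      finally have "qball d x (\<delta> powi int n) \<subseteq> qball d (z (int n) \<alpha>) (c2 * \<delta> powi int n)"
        by (rule qball_subset)
      then show ?thesis using dist by (auto simp: qball_def)
    qed
    have L: "0 \<le> log_weight \<delta> s b (d x y)" by (simp add: log_weight_def)
    have "norm (f x - f y) \<le> K1 * norm (A (int n) \<alpha> *v (f x - f y))" using le1[OF \<alpha>(1) QR] .
    also have "\<dots> = K1 * norm (A (int n) \<alpha> *v f x - A (int n) \<alpha> *v f y)"
      by (simp add: matrix_vector_mult_diff_distrib)
    also have "\<dots> \<le> K1 * (log_weight \<delta> s b (d x y) * (norm (A (int n) \<alpha> *v g (int n) x) + norm (A (int n) \<alpha> *v g (int n) y)))"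
      using grad[OF \<alpha> good(1) good(1) dist] x y K1 by (intro mult_left_mono) auto
    also have "\<dots> \<le> K1 * (log_weight \<delta> s b (d x y) *
        (K2 * weighted_norm W p x (g (int n) x) + K2 * weighted_norm W p y (g (int n) y)))"
      using K1 L x y by (intro mult_left_mono add_mono good(2)[OF _ \<alpha>(1) QR] xB yB) auto
    finally show ?thesis by (simp add: algebra_simps)
  qed
  then show thesis using N' K1 K2 by (intro that[of N' "K1 * K2"]) auto
qed

end

section \<open>Local integrability\<close>

text \<open>With \<open>s' = D' / p - \<gamma>\<close>, the conditions \<open>s' < s\<close> and
  \<open>\<gamma> < D'\<close> are compatible if \<open>D' / p - s < D'\<close>. For
  \<open>D' = D\<close> this is the hypothesis on \<open>p\<close>; being strict, it survives a
  small increase of \<open>D\<close>.\<close>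

lemma exists_embedding_exponents:
  fixes D s p :: real
  assumes D: "0 \<le> D" and s: "0 < s" and p: "D / (D + s) < p" "0 < p" "p \<le> 1"
  obtains D' \<gamma> s' where "D < D'" "0 < \<gamma>" "\<gamma> < D'" "0 < s'" "s' < s" "s' * p = D' - p * \<gamma>"
proof -
  define \<sigma> where "\<sigma> = s - D * (1 / p - 1)"
  have "D < p * (D + s)" using p D s by (simp add: pos_divide_less_eq)
  then have "D / p < D + s" using p by (simp add: pos_divide_less_eq mult.commute)
  then have \<sigma>: "0 < \<sigma>" by (simp add: \<sigma>_def algebra_simps)
  \<comment> \<open>\<open>\<sigma>\<close> is the slack in the hypothesis on \<open>p\<close>. This
    increment raises \<open>D' / p - D'\<close> by \<open>\<sigma> * (1 - p)\<close>, which is less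
    than the slack.\<close>
  define D' where "D' = D + \<sigma> * p"
  have D': "D < D'" using \<sigma> p by (simp add: D'_def)
  have "D' / p - D' = D * (1 / p - 1) + \<sigma> * (1 - p)"
    using p by (simp add: D'_def field_simps)
  also have "\<dots> < D * (1 / p - 1) + \<sigma>" using \<sigma> p by (simp add: right_diff_distrib)
  finally have less: "D' / p - s < D'" by (simp add: \<sigma>_def)
  \<comment> \<open>The maximum with 0 makes the midpoint \<open>\<gamma>\<close> positive.\<close>
  obtain \<mu> where \<mu>: "0 \<le> \<mu>" "\<mu> < D'" "D' / p - s \<le> \<mu>"
    using less D D' that[of "max 0 (D' / p - s)"] by auto
  define \<gamma> where "\<gamma> = (\<mu> + D') / 2"
  have "0 < \<gamma>" "\<gamma> < D'" "\<mu> < \<gamma>" using \<mu>(1,2) by (auto simp: \<gamma>_def)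
  then have \<gamma>: "0 < \<gamma>" "\<gamma> < D'" "D' / p - s < \<gamma>" using le_less_trans[OF \<mu>(3)] by auto
  have "D' \<le> D' / p" using p D D' by (simp add: le_divide_eq mult_left_le)
  then show thesis
    using \<gamma> D' p by (intro that[of D' \<gamma> "D' / p - \<gamma>"]) (auto simp: left_diff_distrib)
qed

context dyadic_system
begin

lemma hajlasz_besov_locally_integrable_le_1:
  fixes W :: "'a \<Rightarrow> complex^'m^'m"
  assumes W: "W \<in> Ap_weights d M p" and p: "0 < p" "p \<le> 1" and red: "reducing_operators M I Q p W A"
    and f: "f \<in> borel_measurable M"
    and g: "g \<in> hajlasz_gradients M d \<delta> I Q A s b f"
    and G: "0 \<le> G" "\<And>k. (\<integral>\<^sup>+x. ennreal (weighted_norm W p x (g k x) powr p) \<partial>M) \<le> ennreal G"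
    and s: "0 < s" "upper_dim d M / (upper_dim d M + s) < p"
  shows "\<exists>r>0. (\<integral>\<^sup>+x\<in>qball d x0 r. ennreal (norm (f x)) \<partial>M) < \<infinity>"
proof -
  obtain D \<gamma> s' where D: "upper_dim d M < D" and \<gamma>: "0 < \<gamma>" "\<gamma> < D" and
    s': "0 < s'" "s' < s" "s' * p = D - p * \<gamma>"
    by (rule exists_embedding_exponents[OF upper_dim_nonneg s p])
  note \<delta> = delta_pos delta_less_1
  obtain N C1 where N: "N \<in> null_sets M" and C1: "0 < C1" and osc:
    "\<And>n x y. x \<in> qball d x0 1 - N \<Longrightarrow> y \<in> qball d x0 1 - N \<Longrightarrow>
      d x y \<in> {\<delta> powi (int n + 1)..<\<delta> powi int n} \<Longrightarrow>
      norm (f x - f y) \<le> C1 * log_weight \<delta> s b (d x y) *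
        (weighted_norm W p x (g (int n) x) + weighted_norm W p y (g (int n) y))"
    by (rule local_oscillation[OF W p red g]) (rule that)
  obtain C2 where C2: "0 < C2" "\<And>t. 0 < t \<Longrightarrow> t < 1 \<Longrightarrow> log_weight \<delta> s b t \<le> C2 * t powr s'"
    using log_weight_le_powr[OF \<delta> s'(2)] by blast
  define C where "C = (C1 * C2) powr p"
  define a where "a = \<delta> powr (D - p * \<gamma>)"
  define h where "h n x = weighted_norm W p x (g (int n) x)" for n x
  have h0: "0 \<le> h n x" for n x by (simp add: h_def)
  have C0: "0 \<le> C" by (simp add: C_def)
  have a_eq: "a = \<delta> powr (s' * p)" by (simp add: a_def s')
  have a: "0 < a" "a < 1"
    unfolding a_eq using \<delta> powr01_less_one[of \<delta> "s' * p"] mult_pos_pos[OF s'(1) p(1)] by simp_all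
  have mw: "matrix_weight d M W" using W by (simp add: Ap_weights_def)
  have g_meas: "g k \<in> borel_measurable M" for k using g by (simp add: hajlasz_gradients_def)
  have [measurable]: "h n \<in> borel_measurable M" for n
    unfolding h_def[abs_def] by (rule weighted_norm_measurable[OF mw p(1) g_meas])
  \<comment> \<open>Up to a constant factor, the p-th power of the contribution of one point to the
    oscillation at scale \<open>\<delta> ^ n\<close>. The choice of \<open>s'\<close> makes the rate
    \<open>a\<close> equal to the one required of \<open>F_int\<close>.\<close>
  define T where "T n x = ennreal (C * a ^ n * h n x powr p)" for n x
  have [measurable]: "T n \<in> borel_measurable M" for n unfolding T_def[abs_def] by simp
  have T_int: "(\<integral>\<^sup>+x. T n x \<partial>M) \<le> ennreal (C * G * a ^ n)" for n
  proof -
    have "(\<integral>\<^sup>+x. T n x \<partial>M) = (\<integral>\<^sup>+x. ennreal (C * a ^ n) * ennreal (h n x powr p) \<partial>M)"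
      unfolding T_def using C0 a by (simp add: ennreal_mult)
    also have "\<dots> = ennreal (C * a ^ n) * (\<integral>\<^sup>+x. ennreal (h n x powr p) \<partial>M)"
      by (rule nn_integral_cmult) simp
    also have "\<dots> \<le> ennreal (C * a ^ n) * ennreal G"
      using G(2)[of "int n"] by (intro mult_left_mono) (auto simp: h_def)
    also have "\<dots> = ennreal (C * G * a ^ n)" using C0 a G by (simp add: mult_ac flip: ennreal_mult)
    finally show ?thesis .
  qed
  define F where "F n x = (\<Sum>i. T (i + n) x)" for n x
  define G' where "G' = C * G / (1 - a)"
  show ?thesis
  proof (rule locally_integrable_of_oscillation_bounds[OF p \<delta> D \<gamma> _ f, of G' F])
    show "0 \<le> G'" using C0 G a by (simp add: G'_def)
    show "F n \<in> borel_measurable M" for n unfolding F_def[abs_def] by simp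
    show "F (Suc n) x \<le> F n x" for n x
      using suminf_offset[of "\<lambda>i. T (i + n) x" 1] by (simp add: F_def)
    show "(\<integral>\<^sup>+x. F n x \<partial>M) \<le> ennreal (G' * (\<delta> powr (D - p * \<gamma>)) ^ n)" for n
    proof -
      have "(\<integral>\<^sup>+x. F n x \<partial>M) = (\<Sum>i. \<integral>\<^sup>+x. T (i + n) x \<partial>M)"
        unfolding F_def by (rule nn_integral_suminf) simp
      also have "\<dots> \<le> (\<Sum>i. ennreal (C * G * a ^ (i + n)))"
        by (intro suminf_le T_int) auto
      also have "\<dots> = ennreal (G' * a ^ n)"
      proof (rule suminf_ennreal_eq)
        have "(\<lambda>i. C * G * a ^ n * a ^ i) sums (C * G * a ^ n * (1 / (1 - a)))"
          using a by (intro sums_mult geometric_sums) auto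
        then show "(\<lambda>i. C * G * a ^ (i + n)) sums (G' * a ^ n)"
          by (simp add: G'_def power_add mult_ac)
      qed (use C0 G a in auto)
      finally show ?thesis by (simp add: a_def)
    qed
    show "N \<in> null_sets M" by (rule N)
    fix n x y
    assume x: "x \<in> qball d x0 1 - N" and y: "y \<in> qball d x0 1 - N" and less: "d x y < \<delta> ^ n"
    show "ennreal (norm (f x - f y) powr p) \<le> F n x + F n y"
    proof (cases "x = y")
      case False
      then have t: "0 < d x y" using d_eq_0_iff[of x y] d_nonneg[of x y] by simp
      have "\<delta> ^ n \<le> 1" using \<delta> by (simp add: power_le_one)
      then have t1: "d x y < 1" using less by simp
      \<comment> \<open>The two points may be much closer than \<open>\<delta> ^ n\<close>. The
        gradient of their true scale \<open>m \<ge> n\<close> must be used, which is why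
        \<open>F n\<close> is a tail sum over all finer levels.\<close>
      obtain m :: nat where m: "d x y \<in> {\<delta> powi (int m + 1)..<\<delta> powi int m}"
        using exists_geometric_scale[OF \<delta> t t1] by blast
      have "\<delta> powi (int m + 1) = \<delta> ^ Suc m"
        using power_int_of_nat[of \<delta> "Suc m"] by (simp add: add.commute)
      then have "\<delta> ^ Suc m < \<delta> ^ n" using m less by simp
      then have "n < Suc m" using \<delta> by (simp add: power_strict_decreasing_iff del: power_Suc)
      then have mn: "n \<le> m" by simp
      have "norm (f x - f y) \<le> C1 * log_weight \<delta> s b (d x y) * (h m x + h m y)"
        unfolding h_def by (rule osc[OF x y m])
      also have "\<dots> \<le> C1 * (C2 * (\<delta> ^ m) powr s') * (h m x + h m y)"
      proof (intro mult_right_mono mult_left_mono)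
        have "log_weight \<delta> s b (d x y) \<le> C2 * d x y powr s'" using C2 t t1 by blast
        also have "\<dots> \<le> C2 * (\<delta> ^ m) powr s'"
          using m t C2 s' by (intro mult_left_mono powr_mono2) auto
        finally show "log_weight \<delta> s b (d x y) \<le> C2 * (\<delta> ^ m) powr s'" .
      qed (use C1 h0 in auto)
      finally have "norm (f x - f y) powr p \<le> (C1 * C2 * (\<delta> ^ m) powr s' * (h m x + h m y)) powr p"
        using p by (intro powr_mono2) (auto simp: mult_ac)
      also have "\<dots> = C * a ^ m * (h m x + h m y) powr p"
      proof -
        have "((\<delta> ^ m) powr s') powr p = a ^ m"
          unfolding a_eq using \<delta> by (simp add: powr_powr mult_ac flip: powr_realpow)
        then show ?thesis using C1 C2 h0 by (simp add: C_def powr_mult)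
      qed
      also have "\<dots> \<le> C * a ^ m * (h m x powr p + h m y powr p)"
        using C0 a p h0 by (intro mult_left_mono powr_add_subadditive) auto
      finally have "ennreal (norm (f x - f y) powr p) \<le> T m x + T m y"
        using C0 a by (simp add: T_def distrib_left flip: ennreal_plus)
      also have "\<dots> \<le> F n x + F n y"
        using mn ennreal_le_suminf[of "\<lambda>i. T (i + n) x" "m - n"] ennreal_le_suminf[of "\<lambda>i. T (i + n) y" "m - n"]
        by (intro add_mono) (auto simp: F_def)
      finally show ?thesis .
    qed simp
  qed
qed

text \<open>All points are compared with one fixed \<open>y0\<close>, so only the finitely many
  cubes that contain \<open>y0\<close> at levels below \<open>n0\<close> matter. The constants may
  therefore depend on the level.\<close>

lemma hajlasz_besov_locally_integrable_gt_1:
  fixes W :: "'a \<Rightarrow> complex^'m^'m"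
  assumes W: "W \<in> Ap_weights d M p" and p: "1 < p" and red: "reducing_operators M I Q p W A"
    and atomless: "\<And>x. emeasure M {x} = 0"
    and f: "f \<in> borel_measurable M"
    and g: "g \<in> hajlasz_gradients M d \<delta> I Q A s b f"
    and G: "\<And>k. (\<integral>\<^sup>+x. ennreal (weighted_norm W p x (g k x) powr p) \<partial>M) < \<infinity>"
    and s: "0 < s"
  shows "\<exists>r>0. (\<integral>\<^sup>+x\<in>qball d x0 r. ennreal (norm (f x)) \<partial>M) < \<infinity>"
proof -
  note \<delta> = delta_pos delta_less_1
  have A0: "0 < A0" using A0_ge_1 by simp
  obtain N where N: "\<And>k. N k \<in> null_sets M" and grad:
    "\<And>k \<alpha> x y. \<alpha> \<in> I k \<Longrightarrow> x \<in> Q k \<alpha> \<Longrightarrow> x \<notin> N k \<Longrightarrow> y \<notin> N k \<Longrightarrow>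
      d x y \<in> {\<delta> powi (k + 1)..<\<delta> powi k} \<Longrightarrow>
      norm (A k \<alpha> *v f x - A k \<alpha> *v f y) \<le>
      log_weight \<delta> s b (d x y) * (norm (A k \<alpha> *v g k x) + norm (A k \<alpha> *v g k y))"
    by (rule hajlasz_gradient_cube[OF g]) (rule that)
  \<comment> \<open>Exponent 0 gives mere boundedness of the weight, enough for finitely many
    scales.\<close>
  obtain C2 where C2: "0 < C2" "\<And>t. 0 < t \<Longrightarrow> t < 1 \<Longrightarrow> log_weight \<delta> s b t \<le> C2 * t powr 0"
    using log_weight_le_powr[OF \<delta> s] by blast
  define N0 where "N0 = (\<Union>n. N (int n))"
  have N0: "N0 \<in> null_sets M" unfolding N0_def using N by (intro null_sets_UN) auto
  define \<rho> where "\<rho> = 1 / (2 * A0)"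
  have \<rho>: "0 < \<rho>" using A0 by (simp add: \<rho>_def)
  \<comment> \<open>\<open>emeasure\<close> is 0 on nonmeasurable sets by default, so measurability
    of the singleton has to be shown as well.\<close>
  have "{x0} \<in> null_sets M"
  proof (rule null_setsI[OF atomless])
    have "{x0} = (\<Inter>n. qball d x0 (1 / Suc n))"
    proof (intro equalityI subsetI)
      fix x assume x: "x \<in> (\<Inter>n. qball d x0 (1 / Suc n))"
      have "d x0 x = 0"
      proof (rule ccontr)
        assume "d x0 x \<noteq> 0"
        then obtain n where "1 / Suc n < d x0 x"
          using d_nonneg[of x0 x] reals_Archimedean[of "d x0 x"] by (auto simp: inverse_eq_divide)
        moreover have "d x0 x < 1 / Suc n" using x by (simp add: qball_def)
        ultimately show False by simp
      qed
      then show "x \<in> {x0}" by (simp add: d_eq_0_iff)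
    qed (auto intro: center_in_qball)
    then show "{x0} \<in> sets M" using qball_sets by auto
  qed
  then have null: "N0 \<union> {x0} \<in> null_sets M" using N0 by blast
  have "\<not> qball d x0 \<rho> \<subseteq> N0 \<union> {x0}"
    using emeasure_mono[of "qball d x0 \<rho>" "N0 \<union> {x0}" M] qball_pos[OF \<rho>, of x0] null
    by (metis leD null_setsD1 null_setsD2)
  then obtain y0 where y0: "y0 \<in> qball d x0 \<rho>" "y0 \<notin> N0" "y0 \<noteq> x0" by blast
  define e where "e = d x0 y0"
  have e: "0 < e" "e < \<rho>"
    using y0 d_nonneg[of x0 y0] d_eq_0_iff[of x0 y0] by (auto simp: e_def qball_def)
  \<comment> \<open>Since \<open>A0 * r0 = e / 2\<close>, the quasi-triangle inequality keeps
    \<open>B\<close> at distance more than \<open>r0\<close> from \<open>y0\<close>; the choice of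
    \<open>\<rho>\<close> keeps it within distance 1. So \<open>B\<close> meets only annuli of
    levels below \<open>n0\<close>.\<close>
  define r0 where "r0 = e / (2 * A0)"
  have r0: "0 < r0" "r0 \<le> e" "A0 * r0 = e / 2"
    using e A0_ge_1 by (auto simp: r0_def field_simps)
  define B where "B = qball d x0 r0"
  have B[measurable]: "B \<in> sets M" by (simp add: B_def qball_sets)
  have dist: "r0 < d y0 y" "d y0 y < 1" if "y \<in> B" for y
  proof -
    have y: "d x0 y < r0" using that by (simp add: B_def qball_def)
    have "e \<le> A0 * (d x0 y + d y y0)" unfolding e_def by (rule d_quasi_triangle)
    also have "\<dots> < A0 * (r0 + d y0 y)" using y A0 by (simp add: d_commute)
    finally have "A0 * r0 < A0 * d y0 y" using r0 by (simp add: distrib_left)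
    then show "r0 < d y0 y" using A0 by simp
    have "d y0 y \<le> A0 * (d y0 x0 + d x0 y)" by (rule d_quasi_triangle)
    also have "\<dots> < A0 * (\<rho> + \<rho>)"
      using y e r0 A0 by (intro mult_strict_left_mono) (auto simp: e_def d_commute)
    also have "\<dots> = 1" using A0 by (simp add: \<rho>_def)
    finally show "d y0 y < 1" .
  qed
  obtain n0 where n0: "\<delta> ^ n0 < r0" using real_arch_pow_inv[OF r0(1) \<delta>(2)] by blast
  have "\<exists>\<alpha>. \<alpha> \<in> I (int n) \<and> y0 \<in> Q (int n) \<alpha>" for n using cubes_cover[of "int n"] by blast
  then obtain \<alpha> where \<alpha>: "\<And>n. \<alpha> n \<in> I (int n)" "\<And>n. y0 \<in> Q (int n) (\<alpha> n)" by metis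
  define A' where "A' n = A (int n) (\<alpha> n)" for n :: nat
  have "\<exists>c>0. \<forall>v. c * norm v \<le> norm (A' n *v v)" for n
    using pos_definite_bounded_below[of "A' n"] red \<alpha>(1) by (metis A'_def reducing_operators_def)
  then obtain c where c: "\<And>n. 0 < c n" "\<And>n v. c n * norm v \<le> norm (A' n *v v)" by metis
  define K where "K n = C2 * op_norm (A' n) / c n" for n
  have K0: "0 \<le> K n" for n using C2 c[of n] by (simp add: K_def op_norm_nonneg)
  \<comment> \<open>The gradient at the fixed point \<open>y0\<close> is a finite number and joins
    the constant; only its value at \<open>y\<close> has to be integrated.\<close>
  define a where "a n = norm (f y0) + K n * norm (g (int n) y0)" for n
  have a0: "0 \<le> a n" for n using K0 by (simp add: a_def)
  have pointwise: "ennreal (norm (f y)) \<le> (\<Sum>n<n0. ennreal (a n) + ennreal (K n) * ennreal (norm (g (int n) y)))"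
    if y: "y \<in> B" "y \<notin> N0" for y
  proof -
    have t: "0 < d y0 y" using dist(1)[OF y(1)] r0 by simp
    obtain n :: nat where n: "d y0 y \<in> {\<delta> powi (int n + 1)..<\<delta> powi int n}"
      using exists_geometric_scale[OF \<delta> t dist(2)[OF y(1)]] by blast
    have "\<delta> ^ n0 < \<delta> ^ n" using n n0 dist(1)[OF y(1)] by simp
    then have nn: "n < n0" using \<delta> by (simp add: power_strict_decreasing_iff)
    have "c n * norm (f y0 - f y) \<le> norm (A' n *v f y0 - A' n *v f y)"
      using c(2)[of n "f y0 - f y"] by (simp add: matrix_vector_mult_diff_distrib)
    also have "\<dots> \<le> log_weight \<delta> s b (d y0 y) * (norm (A' n *v g (int n) y0) + norm (A' n *v g (int n) y))"
      unfolding A'_def using y y0 by (intro grad[OF \<alpha>(1) \<alpha>(2) _ _ n]) (auto simp: N0_def)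
    also have "\<dots> \<le> C2 * (op_norm (A' n) * norm (g (int n) y0) + op_norm (A' n) * norm (g (int n) y))"
      using C2(2)[OF t dist(2)[OF y(1)]] C2(1) t by (intro mult_mono add_mono norm_le_op_norm) auto
    finally have "norm (f y0 - f y) \<le> K n * norm (g (int n) y0) + K n * norm (g (int n) y)"
      using c(1)[of n] by (simp add: K_def field_simps)
    then have "norm (f y) \<le> a n + K n * norm (g (int n) y)"
      using norm_triangle_ineq4[of "f y0" "f y0 - f y"] by (simp add: a_def)
    then have "ennreal (norm (f y)) \<le> ennreal (a n) + ennreal (K n) * ennreal (norm (g (int n) y))"
      using a0[of n] K0[of n] by (simp add: ennreal_leI flip: ennreal_mult ennreal_plus)
    also have "\<dots> \<le> (\<Sum>n<n0. ennreal (a n) + ennreal (K n) * ennreal (norm (g (int n) y)))"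
      using nn by (intro member_le_sum) auto
    finally show ?thesis .
  qed
  have g_meas[measurable]: "g k \<in> borel_measurable M" for k using g by (simp add: hajlasz_gradients_def)
  have "(\<integral>\<^sup>+y\<in>B. ennreal (norm (f y)) \<partial>M) \<le>
      (\<integral>\<^sup>+y. (\<Sum>n<n0. ennreal (a n) * indicator B y + ennreal (K n) * (ennreal (norm (g (int n) y)) * indicator B y)) \<partial>M)"
  proof (rule nn_integral_mono_AE)
    show "AE y in M. ennreal (norm (f y)) * indicator B y \<le>
      (\<Sum>n<n0. ennreal (a n) * indicator B y + ennreal (K n) * (ennreal (norm (g (int n) y)) * indicator B y))"
      using AE_not_in[OF N0] by eventually_elim (use pointwise in \<open>auto simp: indicator_def\<close>)
  qed
  also have "\<dots> = (\<Sum>n<n0. ennreal (a n) * emeasure M B + ennreal (K n) * (\<integral>\<^sup>+y\<in>B. ennreal (norm (g (int n) y)) \<partial>M))"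
    by (simp add: nn_integral_sum nn_integral_add nn_integral_cmult nn_integral_cmult_indicator)
  also have "\<dots> < \<infinity>"
  proof -
    have "(\<integral>\<^sup>+y\<in>B. ennreal (norm (g (int n) y)) \<partial>M) < top" for n
      using weighted_Lp_imp_L1[OF W p r0(1) g_meas G] by (simp add: B_def)
    moreover have "emeasure M B < top" using qball_finite[OF r0(1)] by (simp add: B_def)
    ultimately show ?thesis by (simp add: ennreal_mult_less_top)
  qed
  finally show ?thesis using r0 by (auto simp: B_def)
qed

end

theorem corollary3p12:
  fixes d :: "'a \<Rightarrow> 'a \<Rightarrow> real" and A0 :: real and M :: "'a measure"
    and \<delta> c0 C0 :: real and I :: "int \<Rightarrow> 'i set" and z :: "int \<Rightarrow> 'i \<Rightarrow> 'a"
    and Q :: "int \<Rightarrow> 'i \<Rightarrow> 'a set"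
    and W :: "'a \<Rightarrow> complex^'m^'m" and A :: "int \<Rightarrow> 'i \<Rightarrow> complex^'m^'m"
    and s p :: real and b :: "real \<times> real" and q :: ennreal
    and f :: "'a \<Rightarrow> complex^'m"
  assumes "homogeneous_space d A0 M"
    and "\<forall>x. emeasure M {x} = 0"
    and "dyadic_system d A0 M \<delta> c0 C0 I z Q"
    and "0 < s"
    and "upper_dim d M / (upper_dim d M + s) < p"
    and "0 < q"
    and "W \<in> Ap_weights d M p"
    and "reducing_operators M I Q p W A"
    and "f \<in> hajlasz_besov_space M d \<delta> I Q A s b p q W"
  shows "f \<in> L1_loc_vec d M"
proof -
  interpret dyadic_system d A0 M \<delta> c0 C0 I z Q by fact
  note W = \<open>W \<in> Ap_weights d M p\<close> and red = \<open>reducing_operators M I Q p W A\<close>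
  have "0 \<le> upper_dim d M / (upper_dim d M + s)" using upper_dim_nonneg \<open>0 < s\<close> by simp
  then have p: "0 < p" using assms(5) by simp
  have f: "f \<in> borel_measurable M" and "hajlasz_besov_norm M d \<delta> I Q A s b p q W f < \<infinity>"
    using assms(9) by (auto simp: hajlasz_besov_space_def)
  then obtain g where g: "g \<in> hajlasz_gradients M d \<delta> I Q A s b f"
    and "weighted_lq_Lp_norm M p q W g < \<infinity>"
    unfolding hajlasz_besov_norm_def INF_less_iff by blast
  then obtain G where G: "0 \<le> G"
    "\<And>k. (\<integral>\<^sup>+x. ennreal (weighted_norm W p x (g k x) powr p) \<partial>M) \<le> ennreal G"
    using weighted_lq_Lp_norm_bounded[OF _ p \<open>0 < q\<close>] by blast
  have ball: "\<exists>r>0. (\<integral>\<^sup>+x\<in>qball d x0 r. ennreal (norm (f x)) \<partial>M) < \<infinity>" for x0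
  proof (cases "p \<le> 1")
    case True
    show ?thesis
      by (rule hajlasz_besov_locally_integrable_le_1[OF W p True red f g G \<open>0 < s\<close> assms(5)])
  next
    case False
    then have "1 < p" by simp
    moreover have "(\<integral>\<^sup>+x. ennreal (weighted_norm W p x (g k x) powr p) \<partial>M) < \<infinity>" for k
      using G(2)[of k] by (simp add: le_less_trans)
    ultimately show ?thesis
      using hajlasz_besov_locally_integrable_gt_1[OF W _ red _ f g _ \<open>0 < s\<close>] assms(2) by blast
  qed
  have "(\<lambda>x. f x $ i) \<in> L1_loc d M" for i
    unfolding L1_loc_def
  proof (intro CollectI conjI allI)
    show meas: "(\<lambda>x. f x $ i) \<in> borel_measurable M" by (rule borel_measurable_vec_nth[OF f])
    fix x0
    obtain r where r: "0 < r" "(\<integral>\<^sup>+x\<in>qball d x0 r. ennreal (norm (f x)) \<partial>M) < \<infinity>"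
      using ball by blast
    have "set_integrable M (qball d x0 r) (\<lambda>x. f x $ i)"
      unfolding set_integrable_def
    proof (rule integrableI_bounded)
      show "(\<lambda>x. indicator (qball d x0 r) x *\<^sub>R f x $ i) \<in> borel_measurable M"
        using meas qball_sets by measurable
      have "(\<integral>\<^sup>+x. ennreal (norm (indicator (qball d x0 r) x *\<^sub>R f x $ i)) \<partial>M) \<le>
          (\<integral>\<^sup>+x\<in>qball d x0 r. ennreal (norm (f x)) \<partial>M)"
        by (intro nn_integral_mono) (auto simp: indicator_def Finite_Cartesian_Product.norm_nth_le ennreal_leI)
      then show "(\<integral>\<^sup>+x. ennreal (norm (indicator (qball d x0 r) x *\<^sub>R f x $ i)) \<partial>M) < \<infinity>"
        using r(2) by (rule le_less_trans)
    qed
    then show "\<exists>r>0. set_integrable M (qball d x0 r) (\<lambda>x. f x $ i)" using r(1) by blast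
  qed
  then show ?thesis by (simp add: L1_loc_vec_def)
qed

end
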